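(* Let $\boldsymbol{Q}\in\mathbb{R}^{dn\times dn}$ be a positive definite block-factorizable matrix defined by $\{\boldsymbol{U}_i\}_{i\in[n]}$ and $\{\boldsymbol{V}_i\}_{i\in[n]}$ in $\mathbb{R}^{d\times d}$, with associated matrices $\boldsymbol{\Phi}_{[i\to j]}\in\mathbb{R}^{dn\times d}$, $1\le i<j\le n+1$, and let $$X^B_{\boldsymbol{Q}}:=\left\{(\boldsymbol{x},\boldsymbol{z},\tau)\in\mathbb{R}^{dn}\times\{0,1\}^n\times\mathbb{R}_+:\ \tau\ge\boldsymbol{x}^\top\boldsymbol{Q}\boldsymbol{x},\ \boldsymbol{x}_{[i]}(1-z_i)=\boldsymbol{0},\ i\in[n]\right\}.$$ Then $\mathrm{cl}\,\mathrm{conv}(X^B_{\boldsymbol{Q}})$ is the set of all $(\boldsymbol{x},\boldsymbol{z},\tau)\in\mathbb{R}^{(d+1)n+1}$ for which there exist $w_{ij},\tau_{ij}\in\mathbb{R}_+$ and $\boldsymbol{h}_{ij}\in\mathbb{R}^d$ for $0\le i<j\le n+1$ such that $$\sum_{i=0}^{\ell-1}w_{i\ell}-\sum_{j=\ell+1}^{n+1}w_{\ell j}=\begin{cases}-1&\text{if }\ell=0\\ 1&\text{if }\ell=n+1\\ 0&\text{otherwise}\end{cases}\qquad \ell\in\{0,\dots,n+1\},$$ $$z_\ell=\sum_{i=0}^{\ell-1}w_{i\ell},\ \ \ell\in[n],\qquad \tau\ge\sum_{i=1}^n\sum_{j=i+1}^{n+1}\tau_{ij},\qquad \sum_{i=1}^n\sum_{j=i+1}^{n+1}\boldsymbol{\Phi}_{[i\to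 j]}\boldsymbol{h}_{ij}=\boldsymbol{x},$$ $$\|\boldsymbol{h}_{ij}\|_2^2\le\tau_{ij}w_{ij},\qquad 1\le i<j\le n+1.$$
   Context: $[n]=\{1,\dots,n\}$; $\mathrm{cl}\,\mathrm{conv}$ denotes the closure of the convex hull. A vector $\boldsymbol{x}\in\mathbb{R}^{dn}$ is viewed as $n$ consecutive subvectors $\boldsymbol{x}_{[i]}\in\mathbb{R}^d$, and matrices in $\mathbb{R}^{dn\times dn}$ have $n^2$ blocks of size $d\times d$. $\boldsymbol{E}_i\in\mathbb{R}^{dn\times d}$ is the block column whose $i$-th $d\times d$ block is the identity and whose other blocks are zero. A symmetric matrix $\boldsymbol{Q}\in\mathbb{R}^{dn\times dn}$ is block-factorizable, defined by $\{\boldsymbol{U}_i\}_{i\in[n]}$, $\{\boldsymbol{V}_i\}_{i\in[n]}\subset\mathbb{R}^{d\times d}$, if its $(i,j)$-th block is $\boldsymbol{U}_i\boldsymbol{V}_j^\top$ for all $i\le j$. When $\boldsymbol{Q}$ is positive definite, $\boldsymbol{U}_i\boldsymbol{V}_i^\top\succ\boldsymbol{0}$ for all $i$ (so $\boldsymbol{U}_i,\boldsymbol{V}_i$ are nonsingular) and $\boldsymbol{U}_i\boldsymbol{V}_i^\top-\boldsymbol{U}_i\boldsymbol{U}_j^{-1}\boldsymbol{V}_j\boldsymbol{U}_i^\top\succ\boldsymbol{0}$ for all $i<j$, so the following matrices are well defined: $$\boldsymbol{\Phi}_{[i\to j]}=\begin{cases}\left(\boldsymbol{E}_i-\boldsymbol{E}_j\boldsymbol{U}_j^{-\top}\boldsymbol{U}_i^\top\right)\left(\boldsymbol{U}_i\boldsymbol{V}_i^\top-\boldsymbol{U}_i\boldsymbol{U}_j^{-1}\boldsymbol{V}_j\boldsymbol{U}_i^\top\right)^{-1/2}&\text{for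 }1\le i<j\le n,\\ \boldsymbol{E}_i\left(\boldsymbol{U}_i\boldsymbol{V}_i^\top\right)^{-1/2}&\text{for }1\le i\le n,\ j=n+1,\end{cases}$$ where $\boldsymbol{M}^{-1/2}$ is the inverse of the positive definite square root of $\boldsymbol{M}\succ\boldsymbol{0}$. *)

theory Defs
  imports "HOL-Analysis.Analysis"
begin

text \<open>
  The index set \<open>[n]\<close> is a finite linearly ordered type \<open>'n\<close> with \<open>n = CARD('n)\<close>, and
  \<open>d = CARD('d)\<close>. Vectors in dimension \<open>dn\<close> have the type \<open>real ^ ('n \<times> 'd)\<close>; the coordinate
  \<open>(i, a)\<close> is the \<open>a\<close>-th entry of the \<open>i\<close>-th subvector.
\<close>

text \<open>
  The nodes \<open>0, ..., n + 1\<close> of the network are natural numbers. \<open>ix k\<close> is the \<open>k\<close>-th smallest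
  element of \<open>'n\<close>; it is meaningful for \<open>1 \<le> k \<le> n\<close> only.
\<close>
definition ix :: "nat \<Rightarrow> 'n::{finite,linorder}" where
  "ix k = sorted_list_of_set UNIV ! (k - 1)"

lemma bij_betw_ix: "bij_betw ix {1..CARD('n)} (UNIV :: 'n::{finite,linorder} set)"
proof -
  let ?L = "sorted_list_of_set (UNIV :: 'n set)"
  have "bij_betw ((!) ?L) {..<CARD('n)} UNIV"
    by (rule bij_betw_nth) auto
  moreover have "bij_betw (\<lambda>k. k - 1) {1..CARD('n)} {..<CARD('n)}"
    by (rule bij_betw_byWitness[where f' = Suc]) auto
  ultimately have "bij_betw ((!) ?L \<circ> (\<lambda>k. k - 1)) {1..CARD('n)} UNIV"
    by (rule bij_betw_trans[rotated])
  moreover have "ix = (!) ?L \<circ> (\<lambda>k. k - 1)"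
    by (rule ext) (simp add: ix_def)
  ultimately show ?thesis
    by (simp only:)
qed

lemma strict_mono_on_ix:
  "strict_mono_on {1..CARD('n)} (ix :: nat \<Rightarrow> 'n::{finite,linorder})"
proof (rule strict_mono_onI)
  fix r s :: nat
  assume rs: "r \<in> {1..CARD('n)}" "s \<in> {1..CARD('n)}" "r < s"
  have "r - 1 < s - 1" "s - 1 < length (sorted_list_of_set (UNIV :: 'n set))"
    using rs by auto
  then have "sorted_list_of_set (UNIV :: 'n set) ! (r - 1) < sorted_list_of_set UNIV ! (s - 1)"
    using sorted_wrt_nth_less[OF strict_sorted_list_of_set] by blast
  then show "(ix r :: 'n) < ix s" by (simp add: ix_def)
qed

definition subvec :: "real ^ ('n::finite \<times> 'd::finite) \<Rightarrow> 'n \<Rightarrow> real ^ 'd" where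
  "subvec x i = (\<chi> a. x $ (i, a))"

definition block ::
  "real ^ ('n::finite \<times> 'd::finite) ^ ('n \<times> 'd) \<Rightarrow> 'n \<Rightarrow> 'n \<Rightarrow> real ^ 'd ^ 'd" where
  "block Q i j = (\<chi> a b. Q $ (i, a) $ (j, b))"

definition block_col :: "'n::finite \<Rightarrow> real ^ 'd::finite ^ ('n \<times> 'd)" where
  "block_col i = (\<chi> p b. if p = (i, b) then 1 else 0)"

definition symmetric_matrix :: "real ^ 'm ^ 'm::finite \<Rightarrow> bool" where
  "symmetric_matrix M \<longleftrightarrow> transpose M = M"

definition pos_def :: "real ^ 'm ^ 'm::finite \<Rightarrow> bool" where
  "pos_def M \<longleftrightarrow> symmetric_matrix M \<and> (\<forall>x. x \<noteq> 0 \<longrightarrow> x \<bullet> (M *v x) > 0)"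

definition block_factorizable ::
  "real ^ ('n \<times> 'd) ^ ('n::{finite,linorder} \<times> 'd::finite) \<Rightarrow>
    ('n \<Rightarrow> real ^ 'd ^ 'd) \<Rightarrow> ('n \<Rightarrow> real ^ 'd ^ 'd) \<Rightarrow> bool" where
  "block_factorizable Q U V \<longleftrightarrow>
    symmetric_matrix Q \<and> (\<forall>i j. i \<le> j \<longrightarrow> block Q i j = U i ** transpose (V j))"

text \<open>
  The positive definite square root is unique if it exists; both definitions below are
  meaningful for positive definite arguments only.
\<close>
definition matrix_sqrt :: "real ^ 'm ^ 'm::finite \<Rightarrow> real ^ 'm ^ 'm" where
  "matrix_sqrt M = (THE S. pos_def S \<and> S ** S = M)"

definition matrix_inv_sqrt :: "real ^ 'm ^ 'm::finite \<Rightarrow> real ^ 'm ^ 'm" where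
  "matrix_inv_sqrt M = matrix_inv (matrix_sqrt M)"

text \<open>
  \<open>Phi U V i j\<close> is meaningful for \<open>1 \<le> i < j \<le> n + 1\<close>; the last branch is the case \<open>j = n + 1\<close>.
\<close>
definition Phi ::
  "('n::{finite,linorder} \<Rightarrow> real ^ 'd ^ 'd) \<Rightarrow> ('n \<Rightarrow> real ^ 'd ^ 'd) \<Rightarrow> nat \<Rightarrow> nat \<Rightarrow>
    real ^ 'd::finite ^ ('n \<times> 'd)" where
  "Phi U V i j =
    (let Ui = U (ix i); Vi = V (ix i); Uj = U (ix j); Vj = V (ix j) in
     if j \<le> CARD('n) then
       (block_col (ix i) - block_col (ix j) ** transpose (matrix_inv Uj) ** transpose Ui) **
         matrix_inv_sqrt
           (Ui ** transpose Vi - Ui ** matrix_inv Uj ** Vj ** transpose Ui)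
     else block_col (ix i) ** matrix_inv_sqrt (Ui ** transpose Vi))"

definition X_B ::
  "real ^ ('n \<times> 'd) ^ ('n::finite \<times> 'd::finite) \<Rightarrow> ((real ^ ('n \<times> 'd)) \<times> (real ^ 'n) \<times> real) set"
  where
  "X_B Q = {(x, z, \<tau>). (\<forall>i. z $ i \<in> {0, 1}) \<and> \<tau> \<ge> 0 \<and> \<tau> \<ge> x \<bullet> (Q *v x) \<and>
     (\<forall>i. (1 - z $ i) *\<^sub>R subvec x i = 0)}"

end

theory Submission
  imports Defs
begin

text \<open>
  A path \<open>0 < i\<^sub>1 < ... < i\<^sub>k < n + 1\<close> of the network is the support of a vector \<open>z\<close>. Block elimination
  shows that the columns of the matrices \<open>Phi U V i j\<close> along the path are \<open>Q\<close>-orthonormal and span the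
  vectors supported on it, because the image of \<open>Phi U V i j\<close> is \<open>Q\<close>-orthogonal to all blocks from \<open>j\<close>
  on. So the points of \<open>X_B Q\<close> are sums of independent contributions of the arcs of a path. A unit flow
  is a convex combination of paths (the law of a Markov chain that moves along arc \<open>(i, j)\<close> with
  probability proportional to \<open>w i j\<close>), which identifies the extended formulation with the convex hull
  itself. It is closed because the flows that represent a bounded set of points are bounded.
\<close>

section \<open>Square roots of positive definite matrices\<close>

text \<open>The orthogonality comes from the shape of the lower blocks: for
  \<open>p < q <= l\<close>, row \<open>l\<close> has \<open>V l ** transpose (U p)\<close> in
  column \<open>p\<close> and \<open>V l ** transpose (U q)\<close> in column \<open>q\<close>. A
  single correction in block \<open>q\<close> therefore cancels all rows from \<open>q\<close> on at
  once. What is left in row \<open>p\<close> is a Schur complement, and its inverse square root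
  makes the columns orthonormal. The square root is given by a definite description, so both its
  existence and its uniqueness are derived, from an eigenbasis. Both inclusions are inductions that
  peel off the first arc of a path, so they are stated for paths starting at an arbitrary node.
  Charging \<open>z\<close> to the tail of an arc makes one arc and the remaining path add up
  exactly. The exponentially many paths are never listed: a convex set is attached to each node, and
  the mean from a node is a convex combination of an arc plus the mean from its head.\<close>

lemma self_adjoint_eigenvector:
  fixes f :: "'a::euclidean_space \<Rightarrow> 'a"
  assumes lin: "linear f" and sa: "\<And>x y. x \<bullet> f y = f x \<bullet> y"
    and S: "subspace S" "f ` S \<subseteq> S" "S \<noteq> {0}"
  obtains v c where "v \<in> S" "norm v = 1" "f v = c *\<^sub>R v"
proof -
  interpret f: linear f by fact
  define K where "K = sphere 0 1 \<inter> S"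
  have "compact K"
    unfolding K_def by (intro compact_Int_closed compact_sphere closed_subspace S)
  moreover obtain u where "u \<in> S" "u \<noteq> 0"
    using S subspace_0 by blast
  then have "inverse (norm u) *\<^sub>R u \<in> K"
    by (simp add: K_def S subspace_scale)
  moreover have "continuous_on K (\<lambda>x. x \<bullet> f x)"
    using linear_continuous_on[of f] lin by (intro continuous_intros) (simp add: linear_conv_bounded_linear)
  ultimately obtain v where v: "v \<in> K" and max: "\<And>x. x \<in> K \<Longrightarrow> x \<bullet> f x \<le> v \<bullet> f v"
    using continuous_attains_sup[of K "\<lambda>x. x \<bullet> f x"] by blast
  define c where "c = v \<bullet> f v"
  define w where "w = f v - c *\<^sub>R v"
  \<comment> \<open>The function \<open>q\<close> is nonnegative on \<open>S\<close> and vanishes at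
    the maximiser \<open>v\<close> of the Rayleigh quotient, so its first-order change along the
    residual \<open>w\<close> has to vanish; that change is a multiple of
    \<open>w \<bullet> w\<close>.\<close>
  define q where "q x = c * (x \<bullet> x) - x \<bullet> f x" for x
  have vS: "v \<in> S" and nv: "v \<bullet> v = 1"
    using v by (auto simp: K_def norm_eq_1)
  have wS: "w \<in> S"
    using vS S by (auto simp: w_def intro!: subspace_diff subspace_scale)
  have q_nonneg: "q x \<ge> 0" if "x \<in> S" for x
  proof (cases "x = 0")
    case False
    have "inverse (norm x) *\<^sub>R x \<in> K"
      using False that by (simp add: K_def S subspace_scale)
    from max[OF this] have "(x \<bullet> f x) / (norm x)\<^sup>2 \<le> c"
      by (simp add: c_def f.scale divide_inverse power2_eq_square mult_ac)
    then show ?thesis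
      using False by (simp add: q_def pos_divide_le_eq dot_square_norm)
  qed (simp add: q_def f.zero)
  have expand: "q (v - r *\<^sub>R w) = r\<^sup>2 * q w + 2 * r * (w \<bullet> w)" for r
  proof -
    have "w \<bullet> f v = w \<bullet> w + c * (w \<bullet> v)"
      by (simp add: w_def inner_diff_right)
    moreover have "v \<bullet> f w = w \<bullet> f v"
      using sa[of v w] by (simp add: inner_commute)
    ultimately show ?thesis
      using nv by (simp add: q_def f.diff f.scale inner_diff_left inner_diff_right c_def[symmetric]
          inner_commute[of v w] power2_eq_square algebra_simps)
  qed
  have "w \<bullet> w \<le> 0"
  proof (rule ccontr)
    assume "\<not> w \<bullet> w \<le> 0"
    then have pos: "w \<bullet> w > 0" by linarith
    \<comment> \<open>A negative step small enough for the linear term of \<open>expand\<close> to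
      beat the quadratic one; the \<open>+ 1\<close> keeps the denominator positive when
      \<open>q w = 0\<close>.\<close>
    define r where "r = - (w \<bullet> w) / (q w + 1)"
    have qw: "q w \<ge> 0" using q_nonneg wS by blast
    have r: "r < 0" using pos qw by (simp add: r_def divide_neg_pos)
    have "q (v - r *\<^sub>R w) \<ge> 0"
      by (intro q_nonneg subspace_diff subspace_scale S vS wS)
    then have "r * (r * q w + 2 * (w \<bullet> w)) \<ge> 0"
      unfolding expand by (simp add: power2_eq_square algebra_simps)
    then have "r * q w + 2 * (w \<bullet> w) \<le> 0"
      using r by (simp add: zero_le_mult_iff)
    moreover have "r * (q w + 1) = - (w \<bullet> w)"
      using qw by (simp add: r_def)
    then have "r * q w = - (w \<bullet> w) - r" by (simp add: algebra_simps)
    ultimately show False using pos r by simp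
  qed
  then have "w = 0" by (metis inner_eq_zero_iff inner_ge_zero order_antisym)
  then have "f v = c *\<^sub>R v" by (simp add: w_def)
  with that vS nv show thesis by (simp add: norm_eq_1)
qed

text \<open>Spectral theorem. By self-adjointness the orthogonal complement of an eigenvector within
  an invariant subspace is invariant again, so induction on the dimension applies. Working with
  invariant subspaces of a fixed \<open>f\<close> avoids restricting the map.\<close>

lemma self_adjoint_eigenbasis:
  fixes f :: "'a::euclidean_space \<Rightarrow> 'a"
  assumes lin: "linear f" and sa: "\<And>x y. x \<bullet> f y = f x \<bullet> y"
    and "subspace S" "f ` S \<subseteq> S"
  shows "\<exists>B c. finite B \<and> pairwise orthogonal B \<and> (\<forall>b\<in>B. norm b = 1 \<and> f b = c b *\<^sub>R b) \<and> span B = S"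
  using assms(3,4)
proof (induction "dim S" arbitrary: S rule: less_induct)
  case less
  interpret f: linear f by fact
  show ?case
  proof (cases "S = {0}")
    case True
    then show ?thesis by (intro exI[of _ "{}"]) auto
  next
    case False
    obtain v d where v: "v \<in> S" "norm v = 1" "f v = d *\<^sub>R v"
      using self_adjoint_eigenvector[OF lin sa less.prems False] by blast
    define T where "T = {x \<in> S. v \<bullet> x = 0}"
    have sT: "subspace T"
      using less.prems(1) unfolding T_def subspace_def by (simp add: inner_add_right)
    have "v \<bullet> f x = 0" if "v \<bullet> x = 0" for x
      using that v(3) by (simp add: sa)
    then have fT: "f ` T \<subseteq> T"
      using less.prems(2) by (auto simp: T_def)
    have vT: "v \<notin> T"
      using v by (auto simp: T_def norm_eq_1)
    have "T \<subset> S" using v(1) vT unfolding T_def by blast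
    then have "dim T < dim S"
      by (metis sT less.prems(1) dim_psubset span_eq_iff)
    from less.hyps[OF this sT fT] obtain B c where B: "finite B" "pairwise orthogonal B"
      "\<forall>b\<in>B. norm b = 1 \<and> f b = c b *\<^sub>R b" "span B = T" by blast
    have BT: "B \<subseteq> T" using B(4) span_superset by blast
    have vB: "v \<notin> B" using vT BT by blast
    have "x \<in> span (insert v B)" if "x \<in> S" for x
    proof -
      have "x - (v \<bullet> x) *\<^sub>R v \<in> T"
        using that v less.prems(1)
        by (auto simp: T_def inner_diff_right norm_eq_1 intro: subspace_diff subspace_scale)
      then have "x - (v \<bullet> x) *\<^sub>R v \<in> span B" using B(4) by simp
      then show ?thesis using span_insert by blast
    qed
    moreover have "span (insert v B) \<subseteq> S"
      using v(1) BT less.prems(1) by (intro span_minimal) (auto simp: T_def)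
    ultimately have "span (insert v B) = S" by blast
    moreover have "pairwise orthogonal (insert v B)"
      using B(2) BT by (auto simp: pairwise_insert T_def orthogonal_def inner_commute)
    ultimately show ?thesis
      using B v vB by (intro exI[of _ "insert v B"] exI[of _ "c(v := d)"]) auto
  qed
qed

lemma symmetric_matrix_inner:
  fixes M :: "real ^ 'm ^ 'm::finite"
  assumes "symmetric_matrix M"
  shows "x \<bullet> (M *v y) = (M *v x) \<bullet> y"
  using assms unfolding symmetric_matrix_def
  by (metis dot_lmul_matrix transpose_matrix_vector)

lemma symmetric_matrix_eigenbasis:
  fixes M :: "real ^ 'm ^ 'm::finite"
  assumes "symmetric_matrix M"
  obtains B c where "finite B" "pairwise orthogonal B" "\<And>b. b \<in> B \<Longrightarrow> norm b = 1"
    "\<And>b. b \<in> B \<Longrightarrow> M *v b = c b *\<^sub>R b" "\<And>x. (\<Sum>b\<in>B. (x \<bullet> b) *\<^sub>R b) = x"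
proof -
  obtain B c where B: "finite B" "pairwise orthogonal B" "\<forall>b\<in>B. norm b = 1 \<and> M *v b = c b *\<^sub>R b"
    "span B = UNIV"
    using self_adjoint_eigenbasis[OF matrix_vector_mul_linear symmetric_matrix_inner[OF assms], of UNIV]
    by auto
  moreover have "(\<Sum>b\<in>B. (x \<bullet> b) *\<^sub>R b) = x" for x
    using B by (intro orthonormal_basis_expand) auto
  ultimately show thesis by (intro that) auto
qed

text \<open>The root \<open>g\<close> acts on an orthonormal eigenbasis of \<open>M\<close> by the
  square roots of the eigenvalues, which are positive.\<close>

lemma pos_def_sqrt_exists:
  fixes M :: "real ^ 'm ^ 'm::finite"
  assumes "pos_def M"
  obtains S where "pos_def S" "S ** S = M"
proof -
  obtain B c where B: "finite B" "pairwise orthogonal B" "\<And>b. b \<in> B \<Longrightarrow> norm b = 1"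
    "\<And>b. b \<in> B \<Longrightarrow> M *v b = c b *\<^sub>R b" and expand: "\<And>x. (\<Sum>b\<in>B. (x \<bullet> b) *\<^sub>R b) = x"
    using symmetric_matrix_eigenbasis assms unfolding pos_def_def by blast
  have c_pos: "c b > 0" if "b \<in> B" for b
  proof -
    have "b \<noteq> 0" using B(3)[OF that] by auto
    then have "b \<bullet> (M *v b) > 0" using assms by (simp add: pos_def_def)
    then show ?thesis using B(3,4)[OF that] by (simp add: norm_eq_1)
  qed
  define g where "g x = (\<Sum>b\<in>B. (sqrt (c b) * (x \<bullet> b)) *\<^sub>R b)" for x
  have lin: "linear g"
    by (auto simp: g_def linear_iff inner_add_left scaleR_add_left distrib_left sum.distrib
        scaleR_sum_right mult_ac)
  have g_inner: "x \<bullet> g y = (\<Sum>b\<in>B. sqrt (c b) * (x \<bullet> b) * (y \<bullet> b))" for x y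
    by (simp add: g_def inner_sum_right mult_ac)
  have orth: "b \<bullet> b' = (if b = b' then 1 else 0)" if "b \<in> B" "b' \<in> B" for b b'
    using that B(2,3) by (auto simp: pairwise_def orthogonal_def norm_eq_1)
  have g_coord: "g x \<bullet> b = sqrt (c b) * (x \<bullet> b)" if "b \<in> B" for x b
    using that B(1) by (simp add: g_def inner_sum_left orth if_distrib cong: sum.cong if_cong)
  have pos: "x \<bullet> g x > 0" if "x \<noteq> 0" for x
  proof -
    have nonneg: "sqrt (c b) * (x \<bullet> b) * (x \<bullet> b) \<ge> 0" if "b \<in> B" for b
      using c_pos[OF that] by (simp add: mult.assoc)
    obtain b where b: "b \<in> B" "x \<bullet> b \<noteq> 0"
      using expand[of x] \<open>x \<noteq> 0\<close> by (metis (no_types, lifting) scaleR_zero_left sum.neutral)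
    have "0 < sqrt (c b) * ((x \<bullet> b) * (x \<bullet> b))"
      using c_pos[OF b(1)] b(2) by (metis mult_pos_pos not_real_square_gt_zero real_sqrt_gt_zero)
    then show ?thesis
      unfolding g_inner using nonneg b(1) B(1) by (intro sum_pos2[of B b]) (auto simp: mult.assoc)
  qed
  define S where "S = matrix g"
  have S: "S *v x = g x" for x
    unfolding S_def using matrix_vector_mul(2)[OF lin] by metis
  have "transpose S = S"
  proof -
    have "x \<bullet> (transpose S *v y) = x \<bullet> (S *v y)" for x y
    proof -
      have "x \<bullet> (transpose S *v y) = (S *v x) \<bullet> y"
        by (metis dot_lmul_matrix inner_commute transpose_matrix_vector)
      also have "\<dots> = x \<bullet> (S *v y)"
        unfolding S inner_commute[of "g x"] g_inner by (simp add: mult_ac)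
      finally show ?thesis .
    qed
    then have "transpose S *v y = S *v y" for y
      by (metis vector_eq_ldot)
    then show ?thesis by (metis matrix_eq)
  qed
  then have "pos_def S" using pos by (simp add: pos_def_def symmetric_matrix_def S)
  moreover have "S ** S = M"
  proof -
    have "g (g x) = M *v x" for x
    proof -
      have "g (g x) = (\<Sum>b\<in>B. (x \<bullet> b) *\<^sub>R (M *v b))"
        unfolding g_def[of "g x"]
        using c_pos by (intro sum.cong refl) (simp add: g_coord B(4) less_imp_le mult_ac flip: mult.assoc)
      also have "\<dots> = M *v (\<Sum>b\<in>B. (x \<bullet> b) *\<^sub>R b)"
        by (simp add: vec.sum matrix_vector_mult_scaleR linear_sum[OF matrix_vector_mul_linear] o_def)
      finally show ?thesis by (simp add: expand)
    qed
    then show ?thesis by (simp add: matrix_eq S flip: matrix_vector_mul_assoc)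
  qed
  ultimately show thesis by (rule that)
qed

text \<open>With \<open>D = S - T\<close>, equality of the squares reads
  \<open>S D + D T = 0\<close>. Tested on a unit eigenvector \<open>b\<close> of \<open>D\<close>,
  this is the eigenvalue times \<open>b \<bullet> (S *v b) + b \<bullet> (T *v b) > 0\<close>, so
  every eigenvalue of \<open>D\<close> is 0.\<close>

lemma pos_def_sqrt_unique:
  fixes S T :: "real ^ 'm ^ 'm::finite"
  assumes S: "pos_def S" and T: "pos_def T" and eq: "S ** S = T ** T"
  shows "S = T"
proof -
  define D where "D = S - T"
  have symS: "symmetric_matrix S" and symT: "symmetric_matrix T"
    using S T by (auto simp: pos_def_def)
  then have "symmetric_matrix D"
    by (simp add: symmetric_matrix_def D_def transpose_def vec_eq_iff)
  then obtain B c where B: "finite B" "pairwise orthogonal B" "\<And>b. b \<in> B \<Longrightarrow> norm b = 1"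
    "\<And>b. b \<in> B \<Longrightarrow> D *v b = c b *\<^sub>R b" and expand: "\<And>x. (\<Sum>b\<in>B. (x \<bullet> b) *\<^sub>R b) = x"
    using symmetric_matrix_eigenbasis by blast
  have "D *v b = 0" if "b \<in> B" for b
  proof -
    have "S *v (S *v b) = T *v (T *v b)"
      by (simp add: eq matrix_vector_mul_assoc)
    then have "S *v (D *v b) + D *v (T *v b) = 0"
      by (simp add: D_def matrix_vector_mult_diff_rdistrib matrix_vector_mult_diff_distrib)
    then have "b \<bullet> (S *v (D *v b)) + b \<bullet> (D *v (T *v b)) = 0"
      by (metis inner_add_right inner_zero_right)
    moreover have "b \<bullet> (D *v (T *v b)) = (D *v b) \<bullet> (T *v b)"
      by (rule symmetric_matrix_inner) fact
    ultimately have "c b * (b \<bullet> (S *v b) + b \<bullet> (T *v b)) = 0"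
      using B(4)[OF that] by (simp add: matrix_vector_mult_scaleR distrib_left)
    moreover have "b \<noteq> 0" using B(3)[OF that] by auto
    then have "b \<bullet> (S *v b) + b \<bullet> (T *v b) > 0"
      using S T by (simp add: pos_def_def add_pos_pos)
    ultimately show ?thesis using B(4)[OF that] by simp
  qed
  then have "D *v x = 0" for x
  proof -
    have "D *v (\<Sum>b\<in>B. (x \<bullet> b) *\<^sub>R b) = (\<Sum>b\<in>B. (x \<bullet> b) *\<^sub>R (D *v b))"
      by (simp add: matrix_vector_mult_scaleR linear_sum[OF matrix_vector_mul_linear] o_def)
    then show ?thesis using \<open>\<And>b. b \<in> B \<Longrightarrow> D *v b = 0\<close> by (simp add: expand)
  qed
  then show ?thesis
    by (simp add: D_def matrix_vector_mult_diff_rdistrib matrix_eq)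
qed

lemma matrix_sqrt:
  fixes M :: "real ^ 'm ^ 'm::finite"
  assumes "pos_def M"
  shows "pos_def (matrix_sqrt M)" "matrix_sqrt M ** matrix_sqrt M = M"
proof -
  have "\<exists>!S. pos_def S \<and> S ** S = M"
    using pos_def_sqrt_exists[OF assms] pos_def_sqrt_unique by metis
  from theI'[OF this] show "pos_def (matrix_sqrt M)" "matrix_sqrt M ** matrix_sqrt M = M"
    by (simp_all add: matrix_sqrt_def)
qed

lemma pos_def_invertible:
  fixes M :: "real ^ 'm ^ 'm::finite"
  assumes "pos_def M"
  shows "invertible M"
proof -
  have "x = 0" if "M *v x = 0" for x
    using assms that unfolding pos_def_def by (metis inner_zero_right less_irrefl)
  then show ?thesis
    by (simp add: invertible_left_inverse matrix_left_invertible_ker)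
qed

lemma matrix_inv_inverse:
  fixes A :: "real ^ 'm ^ 'm::finite"
  assumes "invertible A"
  shows "A ** matrix_inv A = mat 1" "matrix_inv A ** A = mat 1"
  using someI_ex[OF assms[unfolded invertible_def]] by (auto simp: matrix_inv_def)

text \<open>The first identity turns the form of \<open>M\<close> into the Euclidean norm; the
  second provides a preimage of every \<open>y\<close>, that is, surjectivity of the inverse
  root.\<close>

lemma matrix_inv_sqrt:
  fixes M :: "real ^ 'm ^ 'm::finite"
  assumes "pos_def M"
  shows "(matrix_inv_sqrt M *v y) \<bullet> (M *v (matrix_inv_sqrt M *v y)) = (norm y)\<^sup>2"
    and "matrix_inv_sqrt M *v (matrix_sqrt M *v y) = y"
proof -
  note S = matrix_sqrt[OF assms]
  have inv: "matrix_sqrt M ** matrix_inv_sqrt M = mat 1" "matrix_inv_sqrt M ** matrix_sqrt M = mat 1"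
    using pos_def_invertible[OF S(1)] by (auto simp: matrix_inv_sqrt_def matrix_inv_inverse)
  show "matrix_inv_sqrt M *v (matrix_sqrt M *v y) = y"
    by (simp add: matrix_vector_mul_assoc inv)
  let ?r = "matrix_inv_sqrt M *v y"
  have r: "matrix_sqrt M *v ?r = y" by (simp add: matrix_vector_mul_assoc inv)
  have "M *v ?r = matrix_sqrt M *v y"
    by (metis S(2) matrix_vector_mul_assoc r)
  then have "?r \<bullet> (M *v ?r) = (matrix_sqrt M *v ?r) \<bullet> y"
    using S(1) by (simp add: pos_def_def symmetric_matrix_inner)
  then show "?r \<bullet> (M *v ?r) = (norm y)\<^sup>2"
    by (simp add: r dot_square_norm)
qed

section \<open>Block elimination\<close>

lemma ix_exhaust:
  fixes l :: "'n::{finite,linorder}"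
  obtains k where "k \<in> {1..CARD('n)}" "l = ix k"
  using bij_betw_ix[where 'n = 'n] by (metis UNIV_I bij_betw_imp_surj_on imageE)

lemma subvec_simps [simp]:
  "subvec 0 k = 0" "subvec (x + y) k = subvec x k + subvec y k"
  "subvec (x - y) k = subvec x k - subvec y k" "subvec (c *\<^sub>R x) k = c *\<^sub>R subvec x k"
  by (simp_all add: subvec_def vec_eq_iff)

lemma subvec_eqI: "(\<And>k. subvec x k = subvec y k) \<Longrightarrow> x = y"
  by (auto simp: subvec_def vec_eq_iff)

lemma inner_subvec: "x \<bullet> y = (\<Sum>k\<in>UNIV. subvec x k \<bullet> subvec y k)"
  by (simp add: subvec_def inner_vec_def sum.cartesian_product)

lemma subvec_block_col [simp]: "subvec (block_col k *v y) l = (if l = k then y else 0)"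
  by (auto simp: subvec_def block_col_def matrix_vector_mult_def vec_eq_iff mult_delta_left)

lemma subvec_matrix_mult: "subvec (Q *v x) l = (\<Sum>k\<in>UNIV. block Q l k *v subvec x k)"
  by (simp add: subvec_def block_def matrix_vector_mult_def vec_eq_iff sum.cartesian_product)

lemma subvec_matrix_mult_block_col [simp]:
  "subvec (Q *v (block_col k *v y)) l = block Q l k *v y"
  by (simp add: subvec_matrix_mult if_distrib cong: if_cong)

lemma block_symmetric: "symmetric_matrix Q \<Longrightarrow> block Q j i = transpose (block Q i j)"
  by (simp add: symmetric_matrix_def block_def transpose_def vec_eq_iff)

lemma pos_def_block:
  assumes "pos_def Q"
  shows "pos_def (block Q k k)"
  unfolding pos_def_def
proof (intro conjI allI impI)
  show "symmetric_matrix (block Q k k)"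
    using block_symmetric[of Q k k] assms by (simp add: pos_def_def symmetric_matrix_def)
next
  fix y :: "real ^ 'b"
  assume "y \<noteq> 0"
  then have "block_col k *v y \<noteq> (0 :: real ^ ('a \<times> 'b))"
    by (metis subvec_block_col subvec_simps(1))
  then have "0 < (block_col k *v y) \<bullet> (Q *v (block_col k *v y))"
    using assms unfolding pos_def_def by blast
  then show "0 < y \<bullet> (block Q k k *v y)"
    by (simp add: inner_subvec if_distrib[of "\<lambda>v. v \<bullet> _"] cong: if_cong)
qed

context
  fixes Q :: "real ^ ('n::{finite,linorder} \<times> 'd::finite) ^ ('n \<times> 'd)"
    and U V :: "'n \<Rightarrow> real ^ 'd ^ 'd"
  assumes pd: "pos_def Q" and bf: "block_factorizable Q U V"
begin

lemma Q_symmetric: "symmetric_matrix Q"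
  using pd by (simp add: pos_def_def)

lemma block_upper: "k \<le> l \<Longrightarrow> block Q k l = U k ** transpose (V l)"
  using bf by (simp add: block_factorizable_def)

lemma block_lower: "k \<le> l \<Longrightarrow> block Q l k = V l ** transpose (U k)"
  using block_symmetric[OF Q_symmetric, of l k] by (simp add: block_upper matrix_transpose_mul)

text \<open>The diagonal block \<open>U k ** transpose (V k)\<close> is positive definite, so its
  determinant, a product with factor \<open>det (U k)\<close>, is nonzero.\<close>

lemma invertible_U: "invertible (U k)"
proof -
  have "invertible (U k ** transpose (V k))"
    using pos_def_invertible[OF pos_def_block[OF pd, of k]] by (simp add: block_upper)
  then have "det (U k) \<noteq> 0"
    by (simp add: invertible_det_nz det_mul)
  then show ?thesis by (simp add: invertible_det_nz)
qed

lemma transpose_U_inverse: "transpose (U k) ** transpose (matrix_inv (U k)) = mat 1"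
  by (metis invertible_U matrix_inv_inverse(2) matrix_transpose_mul transpose_mat)

text \<open>Symmetry of \<open>matrix_inv (U k) ** V k\<close>: the diagonal block of
  \<open>Q\<close> is symmetric, and congruence by the inverse of \<open>U k\<close> preserves
  this.\<close>

lemma inv_U_V: "matrix_inv (U k) ** V k = transpose (V k) ** transpose (matrix_inv (U k))"
proof -
  let ?W = "matrix_inv (U k)"
  have "?W ** (V k ** transpose (U k)) ** transpose ?W = ?W ** (U k ** transpose (V k)) ** transpose ?W"
    using block_lower[of k k] block_upper[of k k] by simp
  also have "\<dots> = (?W ** U k) ** transpose (V k) ** transpose ?W"
    by (simp add: matrix_mul_assoc)
  also have "\<dots> = transpose (V k) ** transpose ?W"
    by (simp add: matrix_inv_inverse invertible_U)
  also have "?W ** (V k ** transpose (U k)) ** transpose ?W = ?W ** V k ** (transpose (U k) ** transpose ?W)"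
    by (simp add: matrix_mul_assoc)
  finally show ?thesis by (simp add: transpose_U_inverse)
qed

text \<open>\<open>M\<close> is the Schur complement of block \<open>q\<close> in the principal
  submatrix on \<open>p\<close> and \<open>q\<close>, and \<open>L y\<close> completes
  \<open>y\<close> in block \<open>p\<close> so that row \<open>q\<close> of \<open>Q *v L y\<close>
  vanishes. Rows \<open>l\<close> beyond \<open>q\<close> vanish as well, since in columns
  \<open>p\<close> and \<open>q\<close> they share the left factor \<open>V l\<close>.\<close>

lemma elimination:
  fixes p q :: 'n
  assumes "p < q"
  defines "M \<equiv> U p ** transpose (V p) - U p ** matrix_inv (U q) ** V q ** transpose (U p)"
  defines "L \<equiv> \<lambda>y. block_col p *v y -
    block_col q *v (transpose (matrix_inv (U q)) *v (transpose (U p) *v y))"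
  shows "q \<le> l \<Longrightarrow> subvec (Q *v L y) l = 0"
    and "L y \<bullet> (Q *v L y) = y \<bullet> (M *v y)"
    and "pos_def M"
proof -
  let ?W = "matrix_inv (U q)"
  have QL: "subvec (Q *v L y) l =
      block Q l p *v y - block Q l q *v (transpose ?W *v (transpose (U p) *v y))" for y l
    by (simp add: L_def matrix_vector_mult_diff_distrib)
  show orth: "subvec (Q *v L y) l = 0" if "q \<le> l" for l y
  proof -
    have "block Q l q *v (transpose ?W *v (transpose (U p) *v y)) =
        (V l ** (transpose (U q) ** transpose ?W) ** transpose (U p)) *v y"
      using that by (simp add: block_lower matrix_vector_mul_assoc matrix_mul_assoc
          del: transpose_matrix_vector)
    then show ?thesis
      using that \<open>p < q\<close> by (simp add: QL block_lower transpose_U_inverse)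
  qed
  have "block Q p q *v (transpose ?W *v (transpose (U p) *v y)) =
      (U p ** (transpose (V q) ** transpose ?W) ** transpose (U p)) *v y" for y
    using \<open>p < q\<close> by (simp add: block_upper matrix_vector_mul_assoc matrix_mul_assoc
          del: transpose_matrix_vector)
  then have Qp: "subvec (Q *v L y) p = M *v y" for y
    by (simp add: QL block_upper M_def matrix_vector_mult_diff_rdistrib matrix_mul_assoc
        flip: inv_U_V)
  \<comment> \<open>\<open>L y\<close> lives in blocks \<open>p\<close> and \<open>q\<close>, and
    \<open>Q *v L y\<close> is zero in block \<open>q\<close>, so only block \<open>p\<close>
    contributes to the form.\<close>
  have "subvec (L y) k \<bullet> subvec (Q *v L y) k = (if k = p then y \<bullet> (M *v y) else 0)" for k y
    using \<open>p < q\<close> orth[of q y] by (auto simp: Qp) (auto simp: L_def)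
  then show form: "L y \<bullet> (Q *v L y) = y \<bullet> (M *v y)" for y
    by (simp add: inner_subvec)
  show "pos_def M"
    unfolding pos_def_def
  proof (intro conjI allI impI)
    have "transpose (U p ** (?W ** V q) ** transpose (U p)) = U p ** (?W ** V q) ** transpose (U p)"
      by (subst (1) inv_U_V) (simp add: matrix_transpose_mul matrix_mul_assoc)
    moreover have "transpose (U p ** transpose (V p)) = U p ** transpose (V p)"
      using block_symmetric[OF Q_symmetric, of p p] by (simp add: block_upper)
    moreover have "transpose (A - B) = transpose A - transpose B" for A B :: "real ^ 'd ^ 'd"
      by (simp add: transpose_def vec_eq_iff)
    ultimately show "symmetric_matrix M"
      by (simp add: symmetric_matrix_def M_def matrix_mul_assoc)
  next
    fix y :: "real ^ 'd"
    assume "y \<noteq> 0"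
    moreover have "subvec (L y) p = y"
      using \<open>p < q\<close> by (simp add: L_def)
    ultimately have "L y \<noteq> 0" by auto
    then show "0 < y \<bullet> (M *v y)"
      using pd by (simp add: pos_def_def flip: form)
  qed
qed

text \<open>Common interface for both branches of \<open>Phi\<close>. In the branch
  \<open>j = n + 1\<close> the index \<open>ix j\<close> has no meaning, hence the guards
  \<open>j \<le> CARD('n)\<close>.\<close>

lemma Phi_eq_elimination:
  assumes "1 \<le> i" "i < j" "j \<le> CARD('n) + 1"
  obtains M L where "pos_def M" "\<And>\<eta>. Phi U V i j *v \<eta> = L (matrix_inv_sqrt M *v \<eta>)"
    "\<And>y. subvec (L y) (ix i) = y"
    "\<And>y k. k \<noteq> ix i \<Longrightarrow> j \<le> CARD('n) \<Longrightarrow> k \<noteq> ix j \<Longrightarrow> subvec (L y) k = 0"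
    "\<And>y k. k \<noteq> ix i \<Longrightarrow> \<not> j \<le> CARD('n) \<Longrightarrow> subvec (L y) k = 0"
    "\<And>y k. j \<le> CARD('n) \<Longrightarrow> ix j \<le> k \<Longrightarrow> subvec (Q *v L y) k = 0"
    "\<And>y. L y \<bullet> (Q *v L y) = y \<bullet> (M *v y)"
proof (cases "j \<le> CARD('n)")
  case True
  have less: "(ix i :: 'n) < ix j"
    using strict_mono_on_ix[where 'n = 'n] assms True by (auto simp: strict_mono_on_def)
  show thesis
    by (rule that[OF elimination(3)[OF less] _ _ _ _ elimination(1)[OF less] elimination(2)[OF less]])
       (use True less in \<open>auto simp: Phi_def Let_def matrix_vector_mult_diff_rdistrib
          simp flip: matrix_vector_mul_assoc simp del: transpose_matrix_vector\<close>)
next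
  case False
  have "(block_col p *v y) \<bullet> (Q *v (block_col p *v y)) = y \<bullet> (U p ** transpose (V p) *v y)" for p y
    by (simp add: inner_subvec if_distrib[of "\<lambda>v. v \<bullet> _"] block_upper cong: if_cong)
  moreover have "pos_def (U (ix i) ** transpose (V (ix i)))"
    using pos_def_block[OF pd, of "ix i"] by (simp add: block_upper)
  ultimately show thesis
    using False
    by (intro that[of "U (ix i) ** transpose (V (ix i))" "\<lambda>y. block_col (ix i) *v y"])
       (auto simp: Phi_def Let_def matrix_vector_mul_assoc)
qed

context
  fixes i j :: nat
  assumes ij: "1 \<le> i" "i < j" "j \<le> CARD('n) + 1"
begin

lemma Phi_form: "(Phi U V i j *v \<eta>) \<bullet> (Q *v (Phi U V i j *v \<eta>)) = (norm \<eta>)\<^sup>2"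
  using Phi_eq_elimination[OF ij] matrix_inv_sqrt(1) by metis

text \<open>Allows the block of the tail of an arc to be matched exactly, so that subtracting the
  arc clears it.\<close>

lemma Phi_surj: "\<exists>\<eta>. subvec (Phi U V i j *v \<eta>) (ix i) = y"
  using Phi_eq_elimination[OF ij] matrix_inv_sqrt(2) by metis

lemma Phi_support:
  assumes "k \<in> {1..CARD('n)}" "k \<noteq> i" "k \<noteq> j"
  shows "subvec (Phi U V i j *v \<eta>) (ix k) = 0"
proof -
  have "inj_on (ix :: nat \<Rightarrow> 'n) {1..CARD('n)}"
    using bij_betw_ix by (rule bij_betw_imp_inj_on)
  then have "(ix k :: 'n) \<noteq> ix i" "j \<le> CARD('n) \<Longrightarrow> (ix k :: 'n) \<noteq> ix j"
    using assms ij by (auto simp: inj_on_eq_iff)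
  then show ?thesis
    using Phi_eq_elimination[OF ij] by metis
qed

lemma Phi_orthogonal:
  assumes "j \<le> k" "k \<le> CARD('n)"
  shows "subvec (Q *v (Phi U V i j *v \<eta>)) (ix k) = 0"
proof -
  have "(ix j :: 'n) \<le> ix k"
    using strict_mono_on_ix[where 'n = 'n] assms ij by (auto simp: strict_mono_on_leD)
  then show ?thesis
    using Phi_eq_elimination[OF ij] assms order_trans by metis
qed

text \<open>The vector \<open>x\<close> is supported on nodes from \<open>j\<close> on, exactly
  where \<open>Q *v (Phi U V i j *v \<eta>)\<close> vanishes; the cross terms disappear and the
  costs of an arc and of the remaining path add.\<close>

lemma Phi_pythagoras:
  assumes "\<And>k. k \<in> {1..<j} \<Longrightarrow> k \<le> CARD('n) \<Longrightarrow> subvec x (ix k) = 0"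
  shows "(Phi U V i j *v \<eta> + x) \<bullet> (Q *v (Phi U V i j *v \<eta> + x)) = (norm \<eta>)\<^sup>2 + x \<bullet> (Q *v x)"
proof -
  let ?f = "Phi U V i j *v \<eta>"
  have "subvec x l \<bullet> subvec (Q *v ?f) l = 0" for l
  proof -
    obtain k where k: "k \<in> {1..CARD('n)}" "l = ix k"
      by (rule ix_exhaust)
    then show ?thesis
      using assms[of k] Phi_orthogonal[of k \<eta>] by (cases "k < j") auto
  qed
  then have "x \<bullet> (Q *v ?f) = 0" by (simp add: inner_subvec)
  moreover from this have "?f \<bullet> (Q *v x) = 0"
    by (metis Q_symmetric symmetric_matrix_inner inner_commute)
  ultimately show ?thesis
    by (simp add: matrix_vector_right_distrib inner_add_left inner_add_right Phi_form)
qed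

end
end

section \<open>Points of \<open>X_B Q\<close> as an arc plus the remaining path\<close>

lemma ix_eq_iff:
  "k \<in> {1..CARD('n)} \<Longrightarrow> l \<in> {1..CARD('n)} \<Longrightarrow>
    (ix k :: 'n::{finite,linorder}) = ix l \<longleftrightarrow> k = l"
  using bij_betw_imp_inj_on[OF bij_betw_ix[where 'n = 'n]] by (simp add: inj_on_eq_iff)

lemma quad_form_nonneg: "pos_def Q \<Longrightarrow> 0 \<le> x \<bullet> (Q *v x)"
  by (cases "x = 0") (auto simp: pos_def_def less_imp_le)

text \<open>The points carried by the paths from \<open>l\<close> to \<open>n + 1\<close>. Nodes
  \<open>0\<close> and \<open>n + 1\<close> have no indicator, so \<open>l = 0\<close> gives all of
  \<open>X_B Q\<close>, while at \<open>l = n + 1\<close> only a slack in the last component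
  survives.\<close>

definition X_from ::
  "real ^ ('n \<times> 'd) ^ ('n::{finite,linorder} \<times> 'd::finite) \<Rightarrow> nat \<Rightarrow>
    ((real ^ ('n \<times> 'd)) \<times> (real ^ 'n::{finite,linorder}) \<times> real) set" where
  "X_from Q l = {(x, z, \<tau>) \<in> X_B Q.
     (\<forall>k \<in> {1..CARD('n)}. k < l \<longrightarrow> z $ ix k = 0) \<and> (l \<in> {1..CARD('n)} \<longrightarrow> z $ ix l = 1)}"

text \<open>What a single arc adds to a point; the indicator is charged to the tail. An arc leaving
  \<open>0\<close> adds only slack in the cost, which gives surplus cost a place on every
  path.\<close>

definition arc_set ::
  "('n::{finite,linorder} \<Rightarrow> real ^ 'd ^ 'd) \<Rightarrow> ('n \<Rightarrow> real ^ 'd ^ 'd) \<Rightarrow> nat \<Rightarrow> nat \<Rightarrow>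
    ((real ^ ('n \<times> 'd::finite)) \<times> (real ^ 'n::{finite,linorder}) \<times> real) set" where
  "arc_set U V i j =
    (if i = 0 then {(0, 0, \<theta>) |\<theta>. 0 \<le> \<theta>}
     else {(Phi U V i j *v \<eta>, axis (ix i) 1, \<theta>) |\<eta> \<theta>. (norm \<eta>)\<^sup>2 \<le> \<theta>})"

lemma X_from_0: "X_from Q 0 = X_B Q"
  by (auto simp: X_from_def)

context
  fixes Q :: "real ^ ('n::{finite,linorder} \<times> 'd::finite) ^ ('n \<times> 'd)"
    and U V :: "'n \<Rightarrow> real ^ 'd ^ 'd"
  assumes pd: "pos_def Q" and bf: "block_factorizable Q U V"
begin

lemma mem_X_from:
  "(x, z, \<tau>) \<in> X_from Q l \<longleftrightarrow>
    (\<forall>k \<in> {1..CARD('n)}. (z $ ix k = 0 \<and> subvec x (ix k) = 0 \<and> k \<noteq> l) \<or> (z $ ix k = 1 \<and> l \<le> k)) \<and>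
    x \<bullet> (Q *v x) \<le> \<tau>" (is "?L \<longleftrightarrow> ?R")
proof
  assume L: ?L
  then have *: "z $ ix k = 0 \<and> subvec x (ix k) = 0 \<or> z $ ix k = 1" for k
    by (auto simp: X_from_def X_B_def dest!: spec[of _ "ix k"])
  then show ?R
    using L by (force simp: X_from_def X_B_def)
next
  assume R: ?R
  have "z $ k \<in> {0, 1} \<and> (1 - z $ k) *\<^sub>R subvec x k = 0" for k
    using R by (cases k rule: ix_exhaust) auto
  then have "(x, z, \<tau>) \<in> X_B Q"
    using R quad_form_nonneg[OF pd, of x] by (auto simp: X_B_def)
  then show ?L
    using R by (fastforce simp: X_from_def)
qed

text \<open>The supports of the arc and of the remaining path overlap at most in block
  \<open>j\<close>, where the indicator is already 1 because the remaining path starts there.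
  \<open>Phi_pythagoras\<close> bounds the cost of the sum.\<close>

lemma X_from_arc:
  assumes ij: "i < j" "j \<le> CARD('n) + 1" and a: "a \<in> arc_set U V i j" and y: "y \<in> X_from Q j"
  shows "a + y \<in> X_from Q i"
proof (cases "i = 0")
  case True
  then obtain \<theta> where "a = (0, 0, \<theta>)" "0 \<le> \<theta>"
    using a by (auto simp: arc_set_def)
  moreover obtain x z \<tau> where "y = (x, z, \<tau>)" by (cases y)
  ultimately show ?thesis
    using y ij True by (fastforce simp: mem_X_from)
next
  case False
  then have ij': "1 \<le> i" by simp
  obtain \<eta> \<theta> where a: "a = (Phi U V i j *v \<eta>, axis (ix i) 1, \<theta>)" and \<eta>: "(norm \<eta>)\<^sup>2 \<le> \<theta>"
    using a False by (auto simp: arc_set_def)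
  obtain x z \<tau> where y_eq: "y = (x, z, \<tau>)" by (cases y)
  note y = y[unfolded y_eq mem_X_from]
  have "subvec x (ix k) = 0" if "k \<in> {1..<j}" "k \<le> CARD('n)" for k
    using y that by fastforce
  from Phi_pythagoras[OF pd bf ij' ij this]
  have form: "(Phi U V i j *v \<eta> + x) \<bullet> (Q *v (Phi U V i j *v \<eta> + x)) \<le> \<theta> + \<tau>"
    using y \<eta> by simp
  have "((axis (ix i) 1 + z) $ ix k = 0 \<and> subvec (Phi U V i j *v \<eta> + x) (ix k) = 0 \<and> k \<noteq> i)
      \<or> ((axis (ix i) 1 + z) $ ix k = 1 \<and> i \<le> k)" if k: "k \<in> {1..CARD('n)}" for k
  proof -
    have ax: "axis (ix i) 1 $ (ix k :: 'n) = (if k = i then 1 else 0 :: real)"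
      using k ij ij' ix_eq_iff[of k i, where 'n = 'n] by (auto simp: axis_def)
    have yk: "(z $ ix k = 0 \<and> subvec x (ix k) = 0 \<and> k \<noteq> j) \<or> (z $ ix k = 1 \<and> j \<le> k)"
      using y k by blast
    consider "k = i" | "k = j" | "k \<noteq> i" "k \<noteq> j" by blast
    then show ?thesis
    proof cases
      case 3
      then show ?thesis
        using yk ij Phi_support[OF pd bf ij' ij k, of \<eta>] by (auto simp: ax)
    qed (use yk ij ax in auto)
  qed
  then show ?thesis
    using form by (simp add: a y_eq mem_X_from)
qed

text \<open>The head \<open>j\<close> is the successor of \<open>i\<close> on the path. For
  \<open>i > 0\<close> the arc clears block \<open>i\<close> at the price of changing block
  \<open>j\<close>, which is harmless as \<open>j\<close> is on the path or is the sink. All slack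
  in the cost stays with the remainder.\<close>

lemma X_from_split:
  assumes i: "i \<le> CARD('n)" and y: "y \<in> X_from Q i"
  obtains j a y' where "i < j" "j \<le> CARD('n) + 1" "a \<in> arc_set U V i j" "y' \<in> X_from Q j" "y = a + y'"
proof -
  obtain x z \<tau> where y_eq: "y = (x, z, \<tau>)" by (cases y)
  note y = y[unfolded y_eq mem_X_from]
  \<comment> \<open>The sink satisfies \<open>P\<close>, so a least such node exists even if no
    indicator beyond \<open>i\<close> is 1.\<close>
  define P where "P k \<longleftrightarrow> i < k \<and> (k = CARD('n) + 1 \<or> z $ ix k = 1)" for k
  define j where "j = (LEAST k. P k)"
  have "P (CARD('n) + 1)" using i by (simp add: P_def)
  then have "P j" and j_le: "j \<le> CARD('n) + 1"
    unfolding j_def by (auto intro: LeastI Least_le)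
  then have ij: "i < j" and zj: "j \<le> CARD('n) \<Longrightarrow> z $ ix j = 1" by (auto simp: P_def)
  have gap: "z $ ix k = 0 \<and> subvec x (ix k) = 0" if "k \<in> {1..CARD('n)}" "k < j" "k \<noteq> i" for k
  proof -
    have "\<not> P k" using that(2) unfolding j_def by (rule not_less_Least)
    then show ?thesis using y that by (force simp: P_def)
  qed
  show thesis
  proof (cases "i = 0")
    case True
    have "(x, z, \<tau>) \<in> X_from Q j"
      using y gap True zj by (fastforce simp: mem_X_from)
    with ij j_le show thesis
      by (intro that[of j "0" y]) (auto simp: arc_set_def True y_eq zero_prod_def)
  next
    case False
    then have i1: "1 \<le> i" by simp
    obtain \<eta> where \<eta>: "subvec (Phi U V i j *v \<eta>) (ix i) = subvec x (ix i)"
      using Phi_surj[OF pd bf i1 ij j_le] by blast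
    define x' where "x' = x - Phi U V i j *v \<eta>"
    define z' where "z' = z - axis (ix i) 1"
    have ax: "axis (ix i) 1 $ (ix k :: 'n) = (if k = i then 1 else 0 :: real)" if "k \<in> {1..CARD('n)}" for k
      using that i i1 ix_eq_iff[of k i, where 'n = 'n] by (auto simp: axis_def)
    have supp: "(z' $ ix k = 0 \<and> subvec x' (ix k) = 0 \<and> k \<noteq> j) \<or> (z' $ ix k = 1 \<and> j \<le> k)"
      if k: "k \<in> {1..CARD('n)}" for k
    proof -
      consider "k = i" | "k = j" | "k < j" "k \<noteq> i" | "j < k" by fastforce
      then show ?thesis
      proof cases
        case 1
        then have "z $ ix k = 1" using y k by blast
        then show ?thesis using 1 ij k by (simp add: x'_def z'_def \<eta> ax)
      next
        case 2
        then show ?thesis using ij zj k by (simp add: z'_def ax)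
      next
        case 3
        then show ?thesis
          using gap[OF k] Phi_support[OF pd bf i1 ij j_le k, of \<eta>] k by (simp add: x'_def z'_def ax)
      next
        case 4
        then show ?thesis
          using y ij Phi_support[OF pd bf i1 ij j_le k, of \<eta>] k by (fastforce simp: x'_def z'_def ax)
      qed
    qed
    have "subvec x' (ix k) = 0" if "k \<in> {1..<j}" "k \<le> CARD('n)" for k
      using supp[of k] that by auto
    from Phi_pythagoras[OF pd bf i1 ij j_le this, of \<eta>]
    have "x \<bullet> (Q *v x) = (norm \<eta>)\<^sup>2 + x' \<bullet> (Q *v x')"
      by (simp add: x'_def)
    then have "(x', z', \<tau> - (norm \<eta>)\<^sup>2) \<in> X_from Q j"
      using supp y by (auto simp: mem_X_from)
    moreover have "(Phi U V i j *v \<eta>, axis (ix i) 1, (norm \<eta>)\<^sup>2) \<in> arc_set U V i j"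
      using False by (auto simp: arc_set_def)
    ultimately show thesis
      by (intro that[OF ij j_le]) (auto simp: y_eq x'_def z'_def)
  qed
qed

lemma X_from_sink:
  "(x, z, \<tau>) \<in> X_from Q (CARD('n) + 1) \<longleftrightarrow> x = 0 \<and> z = 0 \<and> 0 \<le> \<tau>" (is "?L \<longleftrightarrow> ?R")
proof
  assume L: ?L
  have "subvec x k = 0 \<and> z $ k = 0" for k
    using L by (cases k rule: ix_exhaust) (fastforce simp: mem_X_from)
  then have "x = 0" "z = 0"
    by (auto intro!: subvec_eqI) (simp add: vec_eq_iff)
  then show ?R using L by (simp add: mem_X_from)
qed (simp add: mem_X_from)

end

section \<open>Flows with conic arc costs\<close>

text \<open>A flow may start at a node of \<open>[n]\<close>, which has no inflow; so \<open>z\<close> is the outflow here.\<close>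
definition flow ::
  "('n::{finite,linorder} \<Rightarrow> real ^ 'd ^ 'd) \<Rightarrow> ('n \<Rightarrow> real ^ 'd ^ 'd) \<Rightarrow> (nat \<Rightarrow> real) \<Rightarrow>
    (nat \<Rightarrow> nat \<Rightarrow> real) \<Rightarrow> (nat \<Rightarrow> nat \<Rightarrow> real) \<Rightarrow> (nat \<Rightarrow> nat \<Rightarrow> real ^ 'd) \<Rightarrow>
    real ^ ('n \<times> 'd::finite) \<Rightarrow> real ^ 'n::{finite,linorder} \<Rightarrow> real \<Rightarrow> bool" where
  "flow U V b w t h x z \<tau> \<longleftrightarrow>
    (\<forall>i j. i < j \<and> j \<le> CARD('n) + 1 \<longrightarrow> w i j \<ge> 0 \<and> t i j \<ge> 0) \<and>
    (\<forall>l \<in> {0..CARD('n) + 1}.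
      (\<Sum>i \<in> {0..<l}. w i l) - (\<Sum>j \<in> {l + 1..CARD('n) + 1}. w l j) = b l) \<and>
    (\<forall>l \<in> {1..CARD('n)}. z $ ix l = (\<Sum>j \<in> {l + 1..CARD('n) + 1}. w l j)) \<and>
    \<tau> \<ge> (\<Sum>i = 1..CARD('n). \<Sum>j = i + 1..CARD('n) + 1. t i j) \<and>
    (\<Sum>i = 1..CARD('n). \<Sum>j = i + 1..CARD('n) + 1. Phi U V i j *v h i j) = x \<and>
    (\<forall>i j. 1 \<le> i \<and> i < j \<and> j \<le> CARD('n) + 1 \<longrightarrow> (norm (h i j))\<^sup>2 \<le> t i j * w i j)"

definition flow_set ::
  "('n::{finite,linorder} \<Rightarrow> real ^ 'd ^ 'd) \<Rightarrow> ('n \<Rightarrow> real ^ 'd ^ 'd) \<Rightarrow> (nat \<Rightarrow> real) \<Rightarrow>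
    ((real ^ ('n \<times> 'd::finite)) \<times> (real ^ 'n::{finite,linorder}) \<times> real) set" where
  "flow_set U V b = {(x, z, \<tau>). \<exists>w t h. flow U V b w t h x z \<tau>}"

text \<open>Inflow minus outflow of one unit sent from \<open>i\<close> to \<open>j\<close>. These
  telescope: the balances of \<open>i\<close> to \<open>j\<close> and of \<open>j\<close> to
  \<open>k\<close> add up to that of \<open>i\<close> to \<open>k\<close>.\<close>

definition unit_balance :: "nat \<Rightarrow> nat \<Rightarrow> nat \<Rightarrow> real" where
  "unit_balance i j l = of_bool (l = j) - of_bool (l = i)"

text \<open>The rotated second-order cone is closed under addition: the cross term is at most
  \<open>2 * sqrt ((s * w) * (t * v))\<close>, and the arithmetic-geometric mean inequality bounds
  it by \<open>s * w + t * v\<close>.\<close>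

lemma norm_add_sq_le_perspective:
  fixes g h :: "'a::real_normed_vector"
  assumes "0 \<le> s" "0 \<le> t" "0 \<le> v" "0 \<le> w" "(norm g)\<^sup>2 \<le> s * v" "(norm h)\<^sup>2 \<le> t * w"
  shows "(norm (g + h))\<^sup>2 \<le> (s + t) * (v + w)"
proof -
  have "norm g * norm h \<le> sqrt (s * v) * sqrt (t * w)"
    using assms by (intro mult_mono real_le_rsqrt) auto
  also have "\<dots> = sqrt ((s * w) * (t * v))"
    by (simp add: real_sqrt_mult mult_ac)
  also have "\<dots> \<le> (s * w + t * v) / 2"
    using assms by (intro arith_geo_mean_sqrt) auto
  finally have "2 * (norm g * norm h) \<le> s * w + t * v" by simp
  moreover have "(norm (g + h))\<^sup>2 \<le> (norm g + norm h)\<^sup>2"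
    by (intro power_mono norm_triangle_ineq) simp
  ultimately show ?thesis
    using assms by (simp add: power2_sum distrib_left distrib_right algebra_simps)
qed

text \<open>Used twice: with scaling it gives convexity, and with telescoping balances it joins an
  arc to the remaining path.\<close>

lemma flow_set_add:
  assumes "p \<in> flow_set U V b" "q \<in> flow_set U V c"
  shows "p + q \<in> flow_set U V (\<lambda>l. b l + c l)"
proof -
  obtain x z \<tau> w t h where p: "p = (x, z, \<tau>)" "flow U V b w t h x z \<tau>"
    using assms(1) by (auto simp: flow_set_def)
  obtain x' z' \<tau>' w' t' h' where q: "q = (x', z', \<tau>')" "flow U V c w' t' h' x' z' \<tau>'"
    using assms(2) by (auto simp: flow_set_def)
  have "flow U V (\<lambda>l. b l + c l) (\<lambda>i j. w i j + w' i j) (\<lambda>i j. t i j + t' i j) (\<lambda>i j. h i j + h' i j)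
      (x + x') (z + z') (\<tau> + \<tau>')"
    unfolding flow_def
  proof (intro conjI ballI allI impI)
    fix l assume l: "l \<in> {0..CARD('a) + 1}"
    have "(\<Sum>i = 0..<l. w i l) - (\<Sum>j = l + 1..CARD('a) + 1. w l j) = b l"
      "(\<Sum>i = 0..<l. w' i l) - (\<Sum>j = l + 1..CARD('a) + 1. w' l j) = c l"
      using p(2) q(2) l unfolding flow_def by blast+
    then show "(\<Sum>i = 0..<l. w i l + w' i l) - (\<Sum>j = l + 1..CARD('a) + 1. w l j + w' l j) = b l + c l"
      unfolding sum.distrib by linarith
  next
    fix i j assume "1 \<le> i \<and> i < j \<and> j \<le> CARD('a) + 1"
    then show "(norm (h i j + h' i j))\<^sup>2 \<le> (t i j + t' i j) * (w i j + w' i j)"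
      using p(2) q(2) unfolding flow_def by (intro norm_add_sq_le_perspective) auto
  next
    have "(\<Sum>i = 1..CARD('a). \<Sum>j = i + 1..CARD('a) + 1. t i j) \<le> \<tau>"
      "(\<Sum>i = 1..CARD('a). \<Sum>j = i + 1..CARD('a) + 1. t' i j) \<le> \<tau>'"
      using p(2) q(2) unfolding flow_def by blast+
    then show "(\<Sum>i = 1..CARD('a). \<Sum>j = i + 1..CARD('a) + 1. t i j + t' i j) \<le> \<tau> + \<tau>'"
      unfolding sum.distrib by linarith
  next
    show "(\<Sum>i = 1..CARD('a). \<Sum>j = i + 1..CARD('a) + 1. Phi U V i j *v (h i j + h' i j)) = x + x'"
      using p(2) q(2) unfolding flow_def matrix_vector_right_distrib sum.distrib by blast
  next
    fix l assume l: "l \<in> {1..CARD('a)}"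
    have "z $ ix l = (\<Sum>j = l + 1..CARD('a) + 1. w l j)"
      "z' $ ix l = (\<Sum>j = l + 1..CARD('a) + 1. w' l j)"
      using p(2) q(2) l unfolding flow_def by blast+
    then show "(z + z') $ ix l = (\<Sum>j = l + 1..CARD('a) + 1. w l j + w' l j)"
      unfolding sum.distrib by simp
  qed (use p(2) q(2) in \<open>simp_all add: flow_def\<close>)
  then show ?thesis by (auto simp: p(1) q(1) flow_set_def)
qed

lemma flow_set_scale:
  assumes "p \<in> flow_set U V b" "0 \<le> r"
  shows "r *\<^sub>R p \<in> flow_set U V (\<lambda>l. r * b l)"
proof -
  obtain x z \<tau> w t h where p: "p = (x, z, \<tau>)" "flow U V b w t h x z \<tau>"
    using assms(1) by (auto simp: flow_set_def)
  have "flow U V (\<lambda>l. r * b l) (\<lambda>i j. r * w i j) (\<lambda>i j. r * t i j) (\<lambda>i j. r *\<^sub>R h i j)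
      (r *\<^sub>R x) (r *\<^sub>R z) (r * \<tau>)"
    unfolding flow_def
  proof (intro conjI ballI allI impI)
    fix i j assume "1 \<le> i \<and> i < j \<and> j \<le> CARD('a) + 1"
    then have "(norm (h i j))\<^sup>2 \<le> t i j * w i j" using p(2) by (simp add: flow_def)
    then have "(r * r) * (norm (h i j))\<^sup>2 \<le> (r * r) * (t i j * w i j)"
      by (intro mult_left_mono) auto
    then show "(norm (r *\<^sub>R h i j))\<^sup>2 \<le> r * t i j * (r * w i j)"
      by (simp add: power_mult_distrib power2_eq_square mult_ac)
  next
    show "(\<Sum>i = 1..CARD('a). \<Sum>j = i + 1..CARD('a) + 1. r * t i j) \<le> r * \<tau>"
      using p(2) assms(2) by (auto simp: flow_def mult_left_mono simp flip: sum_distrib_left)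
  qed (use p(2) assms(2) in \<open>auto simp: flow_def matrix_vector_mult_scaleR
        simp flip: sum_distrib_left scaleR_sum_right right_diff_distrib\<close>)
  then show ?thesis by (auto simp: p(1) flow_set_def)
qed

lemma convex_flow_set: "convex (flow_set U V b)"
proof (rule convexI)
  fix p q and u v :: real
  assume *: "p \<in> flow_set U V b" "q \<in> flow_set U V b" "0 \<le> u" "0 \<le> v" "u + v = 1"
  have "u *\<^sub>R p + v *\<^sub>R q \<in> flow_set U V (\<lambda>l. u * b l + v * b l)"
    using * by (intro flow_set_add flow_set_scale)
  also have "(\<lambda>l. u * b l + v * b l) = b"
    using * by (simp flip: distrib_right)
  finally show "u *\<^sub>R p + v *\<^sub>R q \<in> flow_set U V b" .
qed

lemma flow_set_slack: "0 \<le> \<theta> \<Longrightarrow> (0, 0, \<theta>) \<in> flow_set U V (\<lambda>_. 0)"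
proof -
  assume "0 \<le> \<theta>"
  then have "flow U V (\<lambda>_. 0) (\<lambda>_ _. 0) (\<lambda>_ _. 0) (\<lambda>_ _. 0) 0 0 \<theta>"
    by (simp add: flow_def)
  then show ?thesis by (auto simp: flow_set_def)
qed

text \<open>The outer sum starts at 1, as the cost and position sums of \<open>flow\<close> do, so
  an arc leaving \<open>0\<close> contributes nothing.\<close>

lemma sum_arc_delta:
  fixes c :: "'a::comm_monoid_add" and i j m :: nat
  assumes "i < j" "j \<le> m + 1"
  shows "(\<Sum>a = 1..m. \<Sum>b = a + 1..m + 1. if a = i \<and> b = j then c else 0) = (if i = 0 then 0 else c)"
proof -
  have "(\<Sum>b = a + 1..m + 1. if a = i \<and> b = j then c else 0) = (if a = i then c else 0)" for a
    using assms by (cases "a = i") simp_all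
  then have "(\<Sum>a = 1..m. \<Sum>b = a + 1..m + 1. if a = i \<and> b = j then c else 0) =
      (\<Sum>a = 1..m. if a = i then c else 0)"
    by (simp only:)
  also have "\<dots> = (if i = 0 then 0 else c)"
    using assms by simp
  finally show ?thesis .
qed

lemma arc_set_subset_flow_set:
  fixes U V :: "'n::{finite,linorder} \<Rightarrow> real ^ 'd::finite ^ 'd"
  assumes ij: "i < j" "j \<le> CARD('n) + 1"
  shows "arc_set U V i j \<subseteq> flow_set U V (unit_balance i j)"
proof
  fix p assume p: "p \<in> arc_set U V i j"
  obtain x z \<theta> where p_eq: "p = (x, z, \<theta>)" by (cases p)
  define w where "w a b = (if a = i \<and> b = j then 1 else 0 :: real)" for a b
  have inflow: "(\<Sum>a = 0..<l. w a l) = of_bool (l = j)" for l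
    using ij by (auto simp: w_def)
  have outflow: "(\<Sum>b = l + 1..CARD('n) + 1. w l b) = of_bool (l = i)" for l
    using ij by (auto simp: w_def)
  obtain \<eta> where \<eta>: "x = (if i = 0 then 0 else Phi U V i j *v \<eta>)" "(norm \<eta>)\<^sup>2 \<le> \<theta>"
    and z: "z = (if i = 0 then 0 else axis (ix i) 1)"
    using p by (auto simp: p_eq arc_set_def split: if_splits intro: that[of 0])
  have \<theta>: "0 \<le> \<theta>" using \<eta>(2) by (meson order_trans zero_le_power2)
  have "flow U V (unit_balance i j) w (\<lambda>a b. if a = i \<and> b = j then \<theta> else 0)
      (\<lambda>a b. if a = i \<and> b = j then \<eta> else 0) x z \<theta>"
    unfolding flow_def inflow outflow
  proof (intro conjI ballI allI impI)
    fix l assume l: "l \<in> {1..CARD('n)}"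
    show "z $ ix l = of_bool (l = i)"
    proof (cases "i = 0")
      case False
      then have "i \<in> {1..CARD('n)}" using ij by auto
      then show ?thesis
        using l ix_eq_iff[of l i, where 'n = 'n] False by (auto simp: z axis_def)
    qed (use l z in auto)
  next
    have "Phi U V a b *v (if a = i \<and> b = j then \<eta> else 0) =
        (if a = i \<and> b = j then Phi U V i j *v \<eta> else 0)" for a b
      by auto
    then show "(\<Sum>a = 1..CARD('n). \<Sum>b = a + 1..CARD('n) + 1.
        Phi U V a b *v (if a = i \<and> b = j then \<eta> else 0)) = x"
      using ij by (simp only: sum_arc_delta \<eta>)
  qed (use ij \<theta> \<eta>(2) in \<open>auto simp: w_def unit_balance_def sum_arc_delta[of i j "CARD('n)", simplified]\<close>)
  then show "p \<in> flow_set U V (unit_balance i j)"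
    by (auto simp: flow_set_def p_eq)
qed

text \<open>Induction on the distance to the sink: the first arc is a unit flow from
  \<open>l\<close> to \<open>j\<close>, the remainder one from \<open>j\<close> to the sink, and
  their balances telescope.\<close>

lemma X_from_subset_flow_set:
  fixes Q :: "real ^ ('n::{finite,linorder} \<times> 'd::finite) ^ ('n \<times> 'd)"
  assumes "pos_def Q" "block_factorizable Q U V" "l \<le> CARD('n) + 1"
  shows "X_from Q l \<subseteq> flow_set U V (unit_balance l (CARD('n) + 1))"
  using assms(3)
proof (induction "CARD('n) + 1 - l" arbitrary: l rule: less_induct)
  case less
  show ?case
  proof
    fix y assume y: "y \<in> X_from Q l"
    show "y \<in> flow_set U V (unit_balance l (CARD('n) + 1))"
    proof (cases "l \<le> CARD('n)")
      case True
      obtain j a y' where j: "l < j" "j \<le> CARD('n) + 1" "a \<in> arc_set U V l j" "y' \<in> X_from Q j"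
        and y_eq: "y = a + y'"
        using X_from_split[OF assms(1,2) True y] by blast
      have "y' \<in> flow_set U V (unit_balance j (CARD('n) + 1))"
        using less.hyps[of j] j True diff_less_mono2[of l j "CARD('n) + 1"] by auto
      moreover have "a \<in> flow_set U V (unit_balance l j)"
        using arc_set_subset_flow_set j by blast
      ultimately have "y \<in> flow_set U V (\<lambda>k. unit_balance l j k + unit_balance j (CARD('n) + 1) k)"
        unfolding y_eq by (intro flow_set_add)
      then show ?thesis by (simp add: unit_balance_def[abs_def])
    next
      case False
      then have l: "l = CARD('n) + 1" using less.prems by simp
      obtain \<tau> where "y = (0, 0, \<tau>)" "0 \<le> \<tau>"
        using y unfolding l by (cases y) (use X_from_sink[OF assms(1,2)] in auto)
      then show ?thesis
        by (simp add: l unit_balance_def[abs_def] flow_set_slack)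
    qed
  qed
qed

lemma convex_hull_X_B_subset_flow_set:
  fixes Q :: "real ^ ('n::{finite,linorder} \<times> 'd::finite) ^ ('n \<times> 'd)"
  assumes "pos_def Q" "block_factorizable Q U V"
  shows "convex hull X_B Q \<subseteq> flow_set U V (unit_balance 0 (CARD('n) + 1))"
  using X_from_subset_flow_set[OF assms, of 0]
  by (intro hull_minimal convex_flow_set) (simp add: X_from_0)

section \<open>Decomposition of unit flows\<close>

text \<open>The mean of the total weight \<open>a\<close> collected by a Markov chain on the nodes \<open>0, ..., m\<close> that
  starts in \<open>l\<close> and moves along an arc \<open>(i, j)\<close> with probability proportional to \<open>w i j\<close>.\<close>
function walk_mean ::
  "nat \<Rightarrow> (nat \<Rightarrow> nat \<Rightarrow> real) \<Rightarrow> (nat \<Rightarrow> nat \<Rightarrow> 'a::real_vector) \<Rightarrow> nat \<Rightarrow> 'a" where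
  "walk_mean m w a l = (if m \<le> l then 0
     else (1 / (\<Sum>j = l + 1..m. w l j)) *\<^sub>R (\<Sum>j = l + 1..m. w l j *\<^sub>R (a l j + walk_mean m w a j)))"
  by auto
termination
  by (relation "Wellfounded.measure (\<lambda>(m, w, a, l). m - l)") auto

declare walk_mean.simps [simp del]

text \<open>The mean \<open>g l\<close> lies in \<open>C l\<close>, by backward induction from the
  sink and convexity. Weighting the recursion for \<open>g l\<close> by the outflow of
  \<open>l\<close> and summing over all nodes cancels every inner mean by balance, which leaves the
  flow-weighted sum of \<open>a\<close> equal to \<open>g 0\<close>.\<close>

lemma unit_flow_mean:
  fixes w :: "nat \<Rightarrow> nat \<Rightarrow> real" and a :: "nat \<Rightarrow> nat \<Rightarrow> 'a::real_vector"
  assumes m: "0 < m" and nonneg: "\<And>i j. i < j \<Longrightarrow> j \<le> m \<Longrightarrow> 0 \<le> w i j"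
    and source: "(\<Sum>j = 1..m. w 0 j) = 1"
    and balance: "\<And>l. 0 < l \<Longrightarrow> l < m \<Longrightarrow> (\<Sum>i = 0..<l. w i l) = (\<Sum>j = l + 1..m. w l j)"
    and C: "\<And>l. convex (C l)" "0 \<in> C m"
    and step: "\<And>i j y. i < j \<Longrightarrow> j \<le> m \<Longrightarrow> 0 < w i j \<Longrightarrow> y \<in> C j \<Longrightarrow> a i j + y \<in> C i"
  shows "(\<Sum>i = 0..<m. \<Sum>j = i + 1..m. w i j *\<^sub>R a i j) \<in> C 0"
proof -
  define g where "g = walk_mean m w a"
  define out where "out l = (\<Sum>j = l + 1..m. w l j)" for l
  have g_m: "g m = 0" by (simp add: g_def walk_mean.simps)
  have g_eq: "g l = (1 / out l) *\<^sub>R (\<Sum>j = l + 1..m. w l j *\<^sub>R (a l j + g j))" if "l < m" for l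
    unfolding g_def out_def using that by (subst walk_mean.simps) simp
  \<comment> \<open>Multiplied out, the recursion also holds at nodes without outflow: all their
    arcs have weight 0, so the value of \<open>g\<close> there is immaterial.\<close>
  have out_g: "out l *\<^sub>R g l = (\<Sum>j = l + 1..m. w l j *\<^sub>R (a l j + g j))" if "l < m" for l
  proof (cases "out l = 0")
    case True
    then have "w l j = 0" if "j \<in> {l + 1..m}" for j
      using that nonneg unfolding out_def by (subst (asm) sum_nonneg_eq_0_iff) auto
    then show ?thesis using True by simp
  qed (simp add: g_eq[OF that])
  \<comment> \<open>Restricted to nodes that carry flow, since elsewhere \<open>C l\<close> may be
    empty. The restriction is inherited by heads of arcs of positive weight: their inflow is
    positive, hence by balance their outflow.\<close>
  have mem: "g l \<in> C l" if "l \<le> m" "l = m \<or> 0 < out l" for l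
    using that
  proof (induction "m - l" arbitrary: l rule: less_induct)
    case less
    show ?case
    proof (cases "l = m")
      case False
      then have l: "l < m" "0 < out l" using less.prems by auto
      define J where "J = {j \<in> {l + 1..m}. 0 < w l j}"
      have J: "sum f J = sum f {l + 1..m}" if "\<And>j. w l j = 0 \<Longrightarrow> f j = 0"
        for f :: "nat \<Rightarrow> 'b::comm_monoid_add"
      proof (intro sum.mono_neutral_left ballI)
        fix j assume "j \<in> {l + 1..m} - J"
        then have "w l j = 0" using nonneg[of l j] by (simp add: J_def)
        then show "f j = 0" by (rule that)
      qed (auto simp: J_def)
      have "a l j + g j \<in> C l" if j: "j \<in> J" for j
      proof -
        have lj: "l < j" "j \<le> m" "0 < w l j" using j by (auto simp: J_def)
        have "0 < out j" if "j < m"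
        proof -
          have "w l j \<le> (\<Sum>i = 0..<j. w i j)"
            using lj nonneg by (intro member_le_sum) auto
          then show ?thesis using balance[of j] lj that by (simp add: out_def)
        qed
        then have "j = m \<or> 0 < out j"
          using lj by (metis le_neq_implies_less)
        then have "g j \<in> C j"
          using lj by (intro less.hyps) auto
        then show ?thesis using step lj by blast
      qed
      moreover have "(\<Sum>j\<in>J. w l j / out l) = 1"
        using l by (subst J) (simp_all add: out_def flip: sum_divide_distrib)
      ultimately have "(\<Sum>j\<in>J. (w l j / out l) *\<^sub>R (a l j + g j)) \<in> C l"
        using l by (intro convex_sum C) (auto simp: J_def)
      also have "(\<Sum>j\<in>J. (w l j / out l) *\<^sub>R (a l j + g j)) = g l"
        using l by (subst J) (simp_all add: g_eq scaleR_sum_right)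
      finally show ?thesis .
    qed (use C g_m in simp)
  qed
  \<comment> \<open>Regroup the arcs by their heads: each \<open>g j\<close> then carries the inflow
    of \<open>j\<close>, which is its outflow for inner nodes, and the sink drops out as
    \<open>g m = 0\<close>.\<close>
  have "(\<Sum>l = 0..<m. \<Sum>j = l + 1..m. w l j *\<^sub>R g j) = (\<Sum>l = 0..<m. \<Sum>j | j \<in> {1..m} \<and> l < j. w l j *\<^sub>R g j)"
    by (intro sum.cong) auto
  also have "\<dots> = (\<Sum>j = 1..m. \<Sum>l | l \<in> {0..<m} \<and> l < j. w l j *\<^sub>R g j)"
    by (rule sum.swap_restrict) auto
  also have "\<dots> = (\<Sum>j = 1..m. (\<Sum>l = 0..<j. w l j) *\<^sub>R g j)"
    unfolding scaleR_sum_left by (intro sum.cong) auto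
  also have "\<dots> = (\<Sum>j = 1..<m. (\<Sum>l = 0..<j. w l j) *\<^sub>R g j)"
    using m g_m by (intro sum.mono_neutral_right) auto
  also have "\<dots> = (\<Sum>j = 1..<m. out j *\<^sub>R g j)"
    using balance by (intro sum.cong) (auto simp: out_def)
  finally have tail: "(\<Sum>l = 0..<m. \<Sum>j = l + 1..m. w l j *\<^sub>R g j) = (\<Sum>j = 1..<m. out j *\<^sub>R g j)" .
  have "out 0 *\<^sub>R g 0 + (\<Sum>l = 1..<m. out l *\<^sub>R g l) = (\<Sum>l = 0..<m. out l *\<^sub>R g l)"
    using m by (simp add: sum.atLeast_Suc_lessThan)
  also have "\<dots> = (\<Sum>l = 0..<m. \<Sum>j = l + 1..m. w l j *\<^sub>R (a l j + g j))"
    by (intro sum.cong refl out_g) auto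
  also have "\<dots> = (\<Sum>l = 0..<m. \<Sum>j = l + 1..m. w l j *\<^sub>R a l j) + (\<Sum>l = 1..<m. out l *\<^sub>R g l)"
    by (simp only: scaleR_add_right sum.distrib tail)
  finally have "out 0 *\<^sub>R g 0 = (\<Sum>l = 0..<m. \<Sum>j = l + 1..m. w l j *\<^sub>R a l j)"
    by simp
  moreover have "out 0 = 1" using source by (simp add: out_def)
  ultimately show ?thesis using mem[of 0] m by simp
qed

lemma convex_hull_X_from_arc:
  fixes Q :: "real ^ ('n::{finite,linorder} \<times> 'd::finite) ^ ('n \<times> 'd)"
  assumes "pos_def Q" "block_factorizable Q U V" "i < j" "j \<le> CARD('n) + 1"
    and "a \<in> arc_set U V i j" "y \<in> convex hull X_from Q j"
  shows "a + y \<in> convex hull X_from Q i"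
proof -
  have "(+) a ` X_from Q j \<subseteq> X_from Q i"
    using X_from_arc assms by blast
  then have "(+) a ` (convex hull X_from Q j) \<subseteq> convex hull X_from Q i"
    by (metis convex_hull_translation hull_mono)
  then show ?thesis using assms by blast
qed

text \<open>An arc with \<open>w i j > 0\<close> is rescaled by \<open>1 / w i j\<close>; the cone
  constraint becomes \<open>(norm \<eta>)\<^sup>2 \<le> \<theta>\<close>, so the rescaled arc is in
  \<open>arc_set\<close> and \<open>unit_flow_mean\<close> applies with the hulls of
  \<open>X_from Q l\<close>.\<close>

lemma flow_set_subset_convex_hull_X_B:
  fixes Q :: "real ^ ('n::{finite,linorder} \<times> 'd::finite) ^ ('n \<times> 'd)"
  assumes "pos_def Q" "block_factorizable Q U V"
  shows "flow_set U V (unit_balance 0 (CARD('n) + 1)) \<subseteq> convex hull X_B Q"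
proof
  let ?n = "CARD('n)"
  fix p assume "p \<in> flow_set U V (unit_balance 0 (?n + 1))"
  then obtain x z \<tau> w t h where p: "p = (x, z, \<tau>)"
    and fl: "flow U V (unit_balance 0 (?n + 1)) w t h x z \<tau>"
    by (auto simp: flow_set_def)
  have nonneg: "\<And>i j. i < j \<Longrightarrow> j \<le> ?n + 1 \<Longrightarrow> 0 \<le> w i j"
      "\<And>i j. i < j \<Longrightarrow> j \<le> ?n + 1 \<Longrightarrow> 0 \<le> t i j"
    and bal: "\<And>l. l \<in> {0..?n + 1} \<Longrightarrow> (\<Sum>i = 0..<l. w i l) - (\<Sum>j = l + 1..?n + 1. w l j) = unit_balance 0 (?n + 1) l"
    and z: "\<And>l. l \<in> {1..?n} \<Longrightarrow> z $ ix l = (\<Sum>j = l + 1..?n + 1. w l j)"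
    and \<tau>: "(\<Sum>i = 1..?n. \<Sum>j = i + 1..?n + 1. t i j) \<le> \<tau>"
    and x: "(\<Sum>i = 1..?n. \<Sum>j = i + 1..?n + 1. Phi U V i j *v h i j) = x"
    and cone: "\<And>i j. 1 \<le> i \<Longrightarrow> i < j \<Longrightarrow> j \<le> ?n + 1 \<Longrightarrow> (norm (h i j))\<^sup>2 \<le> t i j * w i j"
    using fl unfolding flow_def by blast+
  \<comment> \<open>Equal to \<open>t i j\<close> on arcs with flow and 0 on arcs without, by
    division by zero. Cost placed on arcs without flow thereby moves into the slack
    \<open>s\<close>.\<close>
  define t' where "t' i j = w i j * (t i j / w i j)" for i j
  define s where "s = \<tau> - (\<Sum>i = 1..?n. \<Sum>j = i + 1..?n + 1. t' i j)"
  have "(\<Sum>i = 1..?n. \<Sum>j = i + 1..?n + 1. t' i j) \<le> (\<Sum>i = 1..?n. \<Sum>j = i + 1..?n + 1. t i j)"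
    using nonneg by (intro sum_mono) (auto simp: t'_def)
  then have s: "0 \<le> s" using \<tau> by (simp add: s_def)
  \<comment> \<open>The slack \<open>s\<close> is charged to the arcs leaving \<open>0\<close>, of which every path uses exactly one.\<close>
  define a where "a i j = (if i = 0 then (0, 0, s)
    else (Phi U V i j *v ((1 / w i j) *\<^sub>R h i j), axis (ix i) 1 :: (real, 'n) vec, t i j / w i j))" for i j
  have arc: "a i j \<in> arc_set U V i j" if "i < j" "j \<le> ?n + 1" "0 < w i j" for i j
  proof (cases "i = 0")
    case False
    have "(norm ((1 / w i j) *\<^sub>R h i j))\<^sup>2 = (norm (h i j))\<^sup>2 / (w i j * w i j)"
      by (simp add: power_divide power2_eq_square)
    also have "\<dots> \<le> (t i j * w i j) / (w i j * w i j)"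
      using cone[of i j] False that by (intro divide_right_mono) auto
    also have "\<dots> = t i j / w i j" using that by simp
    finally show ?thesis using False by (auto simp: arc_set_def a_def)
  qed (use s in \<open>simp add: arc_set_def a_def\<close>)
  have "(\<Sum>i = 0..<?n + 1. \<Sum>j = i + 1..?n + 1. w i j *\<^sub>R a i j) \<in> convex hull X_from Q 0"
  proof (rule unit_flow_mean[where C = "\<lambda>l. convex hull X_from Q l"])
    show "(\<Sum>j = 1..?n + 1. w 0 j) = 1"
      using bal[of 0] by (simp add: unit_balance_def)
    show "(\<Sum>i = 0..<l. w i l) = (\<Sum>j = l + 1..?n + 1. w l j)" if "0 < l" "l < ?n + 1" for l
      using bal[of l] that by (simp add: unit_balance_def)
    have "0 \<in> X_from Q (?n + 1)"
      by (simp only: zero_prod_def X_from_sink[OF assms]) simp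
    then show "0 \<in> convex hull X_from Q (?n + 1)"
      by (rule hull_inc)
  qed (use nonneg convex_hull_X_from_arc[OF assms] arc in auto)
  also have "(\<Sum>i = 0..<?n + 1. \<Sum>j = i + 1..?n + 1. w i j *\<^sub>R a i j) = p"
  proof -
    have split: "(\<Sum>i = 0..<?n + 1. \<Sum>j = i + 1..?n + 1. w i j *\<^sub>R a i j) =
        (0, 0, s) + (\<Sum>i = 1..?n. \<Sum>j = i + 1..?n + 1. w i j *\<^sub>R a i j)"
    proof -
      have "(\<Sum>j = 1..?n + 1. w 0 j) = 1"
        using bal[of 0] by (simp add: unit_balance_def)
      moreover have "a 0 j = (0, 0, s)" for j by (simp add: a_def)
      ultimately have "(\<Sum>j = 1..?n + 1. w 0 j *\<^sub>R a 0 j) = (0, 0, s)"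
        by (simp only: scaleR_one flip: scaleR_sum_left)
      moreover have "{0..<?n + 1} = insert 0 {1..?n}" by auto
      ultimately show ?thesis by (simp only:) simp
    qed
    \<comment> \<open>If \<open>w i j = 0\<close>, the cone constraint forces
      \<open>h i j = 0\<close>, so no position is lost on arcs without flow.\<close>
    have wa: "w i j *\<^sub>R a i j = (Phi U V i j *v h i j, w i j *\<^sub>R axis (ix i) 1, t' i j)"
      if "i \<in> {1..?n}" "j \<in> {i + 1..?n + 1}" for i j
    proof (cases "w i j = 0")
      case True
      then show ?thesis using cone[of i j] that by (simp add: t'_def zero_prod_def)
    next
      case False
      then show ?thesis
        using that by (simp add: a_def t'_def flip: matrix_vector_mult_scaleR)
    qed
    have "(\<Sum>i = 1..?n. \<Sum>j = i + 1..?n + 1. w i j *\<^sub>R a i j) =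
        (\<Sum>i = 1..?n. \<Sum>j = i + 1..?n + 1. (Phi U V i j *v h i j, w i j *\<^sub>R axis (ix i) 1, t' i j))"
      by (intro sum.cong refl wa)
    also have "\<dots> = (x, \<Sum>i = 1..?n. \<Sum>j = i + 1..?n + 1. w i j *\<^sub>R axis (ix i) 1, \<tau> - s)"
      by (simp only: sum_prod x) (simp add: s_def)
    also have "(\<Sum>i = 1..?n. \<Sum>j = i + 1..?n + 1. w i j *\<^sub>R axis (ix i) 1) = z"
    proof -
      have "(\<Sum>i = 1..?n. \<Sum>j = i + 1..?n + 1. w i j *\<^sub>R axis (ix i) (1::real)) =
          (\<Sum>i = 1..?n. z $ ix i *\<^sub>R axis (ix i) 1)"
        using z by (intro sum.cong refl) (simp flip: scaleR_sum_left)
      also have "\<dots> = (\<Sum>k\<in>UNIV. z $ k *\<^sub>R axis k 1)"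
        by (rule sum.reindex_bij_betw[OF bij_betw_ix])
      also have "\<dots> = z"
        by (simp add: vec_eq_iff axis_def if_distrib cong: if_cong)
      finally show ?thesis .
    qed
    finally show ?thesis by (simp only: split p) simp
  qed
  finally show "p \<in> convex hull X_B Q" by (simp add: X_from_0)
qed

section \<open>Closedness\<close>

text \<open>Bolzano-Weierstrass is applied to one index after another; finiteness of
  \<open>A\<close> makes successive thinning sufficient.\<close>

lemma bounded_pointwise_convergent_subsequence:
  fixes f :: "nat \<Rightarrow> 'a \<Rightarrow> 'b::heine_borel"
  assumes "finite A" "\<And>a. a \<in> A \<Longrightarrow> bounded (range (\<lambda>k. f k a))"
  shows "\<exists>r l. strict_mono r \<and> (\<forall>a\<in>A. (\<lambda>k. f (r k) a) \<longlonglongrightarrow> l a)"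
  using assms
proof (induction A rule: finite_induct)
  case empty
  then show ?case by (intro exI[of _ id]) (auto simp: strict_mono_def)
next
  case (insert a A)
  then obtain r l where r: "strict_mono r" "\<forall>b\<in>A. (\<lambda>k. f (r k) b) \<longlonglongrightarrow> l b"
    by auto
  have "bounded (range (\<lambda>k. f (r k) a))"
    using insert.prems[of a] by (rule bounded_subset) auto
  then obtain s c where s: "strict_mono s" "(\<lambda>k. f (r (s k)) a) \<longlonglongrightarrow> c"
    using bounded_imp_convergent_subsequence[of "\<lambda>k. f (r k) a"] by (auto simp: o_def)
  have "(\<lambda>k. f (r (s k)) b) \<longlonglongrightarrow> l b" if "b \<in> A" for b
    using LIMSEQ_subseq_LIMSEQ[OF r(2)[rule_format, OF that] s(1)] by (simp add: o_def)
  then show ?case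
    using r(1) s insert.hyps(2)
    by (intro exI[of _ "r \<circ> s"] exI[of _ "l(a := c)"]) (auto simp: strict_mono_def)
qed

lemma closed_flow_set:
  fixes U V :: "'n::{finite,linorder} \<Rightarrow> real ^ 'd::finite ^ 'd"
  shows "closed (flow_set U V b)"
  unfolding closed_sequential_limits
proof (intro allI impI, elim conjE)
  let ?n = "CARD('n)"
  fix P p assume P: "\<forall>k. P k \<in> flow_set U V b" and lim: "P \<longlonglongrightarrow> p"
  define X where "X k = fst (P k)" for k
  define Z where "Z k = fst (snd (P k))" for k
  define S where "S k = snd (snd (P k))" for k
  obtain x z \<tau> where p: "p = (x, z, \<tau>)" by (cases p)
  have lims: "X \<longlonglongrightarrow> x" "Z \<longlonglongrightarrow> z" "S \<longlonglongrightarrow> \<tau>"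
    using tendsto_fst[OF lim] tendsto_fst[OF tendsto_snd[OF lim]] tendsto_snd[OF tendsto_snd[OF lim]]
    by (simp_all add: p X_def[abs_def] Z_def[abs_def] S_def[abs_def])
  have "\<exists>w t h. flow U V b w t h (X k) (Z k) (S k)" for k
    using P by (auto simp: X_def Z_def S_def flow_set_def split: prod.splits dest!: spec[of _ k])
  then obtain W T H where flow: "\<And>k. flow U V b (W k) (T k) (H k) (X k) (Z k) (S k)" by metis
  have nonneg: "\<And>k i j. i < j \<Longrightarrow> j \<le> ?n + 1 \<Longrightarrow> 0 \<le> W k i j"
      "\<And>k i j. i < j \<Longrightarrow> j \<le> ?n + 1 \<Longrightarrow> 0 \<le> T k i j"
    and bal: "\<And>k l. l \<in> {0..?n + 1} \<Longrightarrow>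
      (\<Sum>i = 0..<l. W k i l) - (\<Sum>j = l + 1..?n + 1. W k l j) = b l"
    and Z: "\<And>k l. l \<in> {1..?n} \<Longrightarrow> Z k $ ix l = (\<Sum>j = l + 1..?n + 1. W k l j)"
    and S: "\<And>k. (\<Sum>i = 1..?n. \<Sum>j = i + 1..?n + 1. T k i j) \<le> S k"
    and X: "\<And>k. (\<Sum>i = 1..?n. \<Sum>j = i + 1..?n + 1. Phi U V i j *v H k i j) = X k"
    and cone: "\<And>k i j. 1 \<le> i \<Longrightarrow> i < j \<Longrightarrow> j \<le> ?n + 1 \<Longrightarrow> (norm (H k i j))\<^sup>2 \<le> T k i j * W k i j"
    using flow unfolding flow_def by blast+
  obtain K0 where K0: "\<And>k. norm (P k) \<le> K0"
    using convergent_imp_bounded[OF lim] by (auto simp: bounded_iff)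
  \<comment> \<open>Node \<open>0\<close> has no inflow, so its outflow is \<open>- b 0\<close>; the
    outflow of a node of \<open>[n]\<close> is a component of \<open>Z k\<close>, bounded by
    \<open>K0\<close>. The costs are bounded by \<open>S k\<close>, and the cone constraint then
    bounds \<open>H\<close> by the same \<open>K\<close>.\<close>
  define K where "K = K0 + \<bar>b 0\<bar>"
  have W_le: "W k i j \<le> K" if "i < j" "j \<le> ?n + 1" for k i j
  proof -
    have "W k i j \<le> (\<Sum>j = i + 1..?n + 1. W k i j)"
      using that nonneg by (intro member_le_sum) auto
    also have "\<dots> \<le> K"
    proof (cases "i = 0")
      case True
      have "0 \<le> K0" using K0 norm_ge_zero order_trans by blast
      then show ?thesis using bal[of 0 k] True by (simp add: K_def)
    next
      case False
      then have "(\<Sum>j = i + 1..?n + 1. W k i j) = Z k $ ix i" using Z that by simp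
      also have "\<dots> \<le> norm (Z k)" using component_le_norm_cart abs_le_D1 by blast
      also have "\<dots> \<le> norm (P k)"
        unfolding Z_def using norm_fst_le norm_snd_le order_trans by (metis prod.collapse)
      finally show ?thesis using K0[of k] by (simp add: K_def)
    qed
    finally show ?thesis .
  qed
  have T_le: "T k i j \<le> K" if "1 \<le> i" "i < j" "j \<le> ?n + 1" for k i j
  proof -
    have "T k i j \<le> (\<Sum>j = i + 1..?n + 1. T k i j)"
      using that nonneg by (intro member_le_sum) auto
    also have "\<dots> \<le> (\<Sum>i = 1..?n. \<Sum>j = i + 1..?n + 1. T k i j)"
      using that nonneg by (intro member_le_sum[where f = "\<lambda>i. \<Sum>j = i + 1..?n + 1. T k i j"] sum_nonneg) auto
    also have "\<dots> \<le> S k" by (rule S)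
    also have "\<dots> \<le> norm (S k)" by simp
    also have "\<dots> \<le> norm (P k)"
      unfolding S_def using norm_snd_le order_trans by (metis prod.collapse)
    finally show ?thesis using K0[of k] by (simp add: K_def)
  qed
  have H_le: "norm (H k i j) \<le> K" if "1 \<le> i" "i < j" "j \<le> ?n + 1" for k i j
  proof (rule power2_le_imp_le)
    show "0 \<le> K" using W_le[OF that(2,3)] nonneg(1)[OF that(2,3)] order_trans by blast
    have "(norm (H k i j))\<^sup>2 \<le> T k i j * W k i j" using cone that by blast
    also have "\<dots> \<le> K * K"
      by (rule mult_mono[OF T_le[OF that] W_le[OF that(2,3)] \<open>0 \<le> K\<close> nonneg(1)[OF that(2,3)]])
    finally show "(norm (H k i j))\<^sup>2 \<le> K\<^sup>2" by (simp add: power2_eq_square)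
  qed
  define A where "A = {(i, j). i < j \<and> j \<le> ?n + 1}"
  have "A \<subseteq> {0..?n + 1} \<times> {0..?n + 1}" by (auto simp: A_def)
  then have "finite A" by (rule finite_subset) simp
  \<comment> \<open>The values of \<open>T\<close> and \<open>H\<close> on the arcs leaving \<open>0\<close> are irrelevant, and they need not be bounded.\<close>
  define f where "f k = (\<lambda>(i, j). (W k i j, if i = 0 then 0 else T k i j, if i = 0 then 0 else H k i j))" for k
  have "bounded (range (\<lambda>k. f k a))" if "a \<in> A" for a
  proof -
    obtain i j where a: "a = (i, j)" "i < j" "j \<le> ?n + 1" using \<open>a \<in> A\<close> by (auto simp: A_def)
    have "norm (f k a) \<le> K + (K + K)" for k
    proof -
      have "0 \<le> K" using W_le[OF a(2,3)] nonneg(1)[OF a(2,3)] order_trans by blast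
      then have "norm (if i = 0 then 0 else T k i j) \<le> K" "norm (if i = 0 then 0 else H k i j) \<le> K"
        using a T_le[of i j k] H_le[of i j k] nonneg(2)[of i j k] by auto
      moreover have "norm (W k i j) \<le> K"
        using a W_le nonneg by simp
      ultimately show ?thesis
        unfolding f_def a(1) prod.case by (intro order_trans[OF norm_Pair_le] add_mono)
    qed
    then show ?thesis by (auto simp: bounded_iff)
  qed
  with \<open>finite A\<close> obtain r L where r: "strict_mono r"
    and L: "\<And>a. a \<in> A \<Longrightarrow> (\<lambda>k. f (r k) a) \<longlonglongrightarrow> L a"
    using bounded_pointwise_convergent_subsequence[of A f] by blast
  define w where "w i j = fst (L (i, j))" for i j
  define t where "t i j = fst (snd (L (i, j)))" for i j
  define h where "h i j = snd (snd (L (i, j)))" for i j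
  have W_lim: "(\<lambda>k. W (r k) i j) \<longlonglongrightarrow> w i j" if "i < j" "j \<le> ?n + 1" for i j
    using tendsto_fst[OF L[of "(i, j)"]] that by (simp add: A_def f_def w_def)
  have T_lim: "(\<lambda>k. if i = 0 then 0 else T (r k) i j) \<longlonglongrightarrow> t i j" if "i < j" "j \<le> ?n + 1" for i j
    using tendsto_fst[OF tendsto_snd[OF L[of "(i, j)"]]] that by (simp add: A_def f_def t_def)
  have T_lim': "(\<lambda>k. T (r k) i j) \<longlonglongrightarrow> t i j" if "1 \<le> i" "i < j" "j \<le> ?n + 1" for i j
    using T_lim[of i j] that by simp
  have H_lim: "(\<lambda>k. H (r k) i j) \<longlonglongrightarrow> h i j" if "1 \<le> i" "i < j" "j \<le> ?n + 1" for i j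
    using tendsto_snd[OF tendsto_snd[OF L[of "(i, j)"]]] that by (simp add: A_def f_def h_def)
  have lims_r: "(\<lambda>k. X (r k)) \<longlonglongrightarrow> x" "(\<lambda>k. Z (r k)) \<longlonglongrightarrow> z" "(\<lambda>k. S (r k)) \<longlonglongrightarrow> \<tau>"
    using lims r by (auto dest: LIMSEQ_subseq_LIMSEQ simp: o_def)
  have "flow U V b w t h x z \<tau>"
    unfolding flow_def
  proof (intro conjI ballI allI impI)
    fix i j assume ij: "i < j \<and> j \<le> ?n + 1"
    show "0 \<le> w i j"
      using ij nonneg by (intro LIMSEQ_le_const[OF W_lim]) auto
    show "0 \<le> t i j"
      using ij nonneg by (intro LIMSEQ_le_const[OF T_lim]) auto
  next
    fix l assume l: "l \<in> {0..?n + 1}"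
    have "(\<lambda>k. (\<Sum>i = 0..<l. W (r k) i l) - (\<Sum>j = l + 1..?n + 1. W (r k) l j)) \<longlonglongrightarrow>
        (\<Sum>i = 0..<l. w i l) - (\<Sum>j = l + 1..?n + 1. w l j)"
      using l by (intro tendsto_diff tendsto_sum W_lim) auto
    then show "(\<Sum>i = 0..<l. w i l) - (\<Sum>j = l + 1..?n + 1. w l j) = b l"
      unfolding bal[OF l] by (simp add: LIMSEQ_const_iff)
  next
    fix l assume l: "l \<in> {1..?n}"
    have "(\<lambda>k. \<Sum>j = l + 1..?n + 1. W (r k) l j) \<longlonglongrightarrow> (\<Sum>j = l + 1..?n + 1. w l j)"
      using l by (intro tendsto_sum W_lim) auto
    moreover have "(\<lambda>k. \<Sum>j = l + 1..?n + 1. W (r k) l j) \<longlonglongrightarrow> z $ ix l"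
      using tendsto_vec_nth[OF lims_r(2), of "ix l"] by (simp only: Z[OF l])
    ultimately show "z $ ix l = (\<Sum>j = l + 1..?n + 1. w l j)"
      by (rule LIMSEQ_unique[rotated])
  next
    have "(\<lambda>k. \<Sum>i = 1..?n. \<Sum>j = i + 1..?n + 1. T (r k) i j) \<longlonglongrightarrow>
        (\<Sum>i = 1..?n. \<Sum>j = i + 1..?n + 1. t i j)"
      by (intro tendsto_sum T_lim') auto
    then show "(\<Sum>i = 1..?n. \<Sum>j = i + 1..?n + 1. t i j) \<le> \<tau>"
      using lims_r(3) S by (intro LIMSEQ_le) auto
  next
    have "(\<lambda>k. \<Sum>i = 1..?n. \<Sum>j = i + 1..?n + 1. Phi U V i j *v H (r k) i j) \<longlonglongrightarrow>
        (\<Sum>i = 1..?n. \<Sum>j = i + 1..?n + 1. Phi U V i j *v h i j)"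
      by (intro tendsto_sum bounded_linear.tendsto[OF matrix_vector_mul_bounded_linear] H_lim) auto
    then show "(\<Sum>i = 1..?n. \<Sum>j = i + 1..?n + 1. Phi U V i j *v h i j) = x"
      unfolding X using lims_r(1) by (rule LIMSEQ_unique)
  next
    fix i j assume ij: "1 \<le> i \<and> i < j \<and> j \<le> ?n + 1"
    show "(norm (h i j))\<^sup>2 \<le> t i j * w i j"
    proof (rule LIMSEQ_le)
      show "(\<lambda>k. (norm (H (r k) i j))\<^sup>2) \<longlonglongrightarrow> (norm (h i j))\<^sup>2"
        using ij by (intro tendsto_intros H_lim) auto
      show "(\<lambda>k. T (r k) i j * W (r k) i j) \<longlonglongrightarrow> t i j * w i j"
        using ij by (intro tendsto_mult T_lim' W_lim) auto
      show "\<exists>N. \<forall>k\<ge>N. (norm (H (r k) i j))\<^sup>2 \<le> T (r k) i j * W (r k) i j"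
        using cone ij by blast
    qed
  qed
  then show "p \<in> flow_set U V b" by (auto simp: flow_set_def p)
qed

theorem proposition10:
  fixes Q :: "real ^ ('n::{finite,linorder} \<times> 'd::finite) ^ ('n \<times> 'd)"
    and U V :: "'n \<Rightarrow> real ^ 'd ^ 'd"
  assumes "pos_def Q"
    and "block_factorizable Q U V"
  shows "closure (convex hull X_B Q) =
    {(x, z, \<tau>).
      \<exists>(w :: nat \<Rightarrow> nat \<Rightarrow> real) (t :: nat \<Rightarrow> nat \<Rightarrow> real) (h :: nat \<Rightarrow> nat \<Rightarrow> real ^ 'd).
        (\<forall>i j. i < j \<and> j \<le> CARD('n) + 1 \<longrightarrow> w i j \<ge> 0 \<and> t i j \<ge> 0) \<and>
        (\<forall>l \<in> {0..CARD('n) + 1}.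
          (\<Sum>i \<in> {0..<l}. w i l) - (\<Sum>j \<in> {l + 1..CARD('n) + 1}. w l j) =
            (if l = 0 then -1 else if l = CARD('n) + 1 then 1 else 0)) \<and>
        (\<forall>l \<in> {1..CARD('n)}. z $ ix l = (\<Sum>i \<in> {0..<l}. w i l)) \<and>
        \<tau> \<ge> (\<Sum>i = 1..CARD('n). \<Sum>j = i + 1..CARD('n) + 1. t i j) \<and>
        (\<Sum>i = 1..CARD('n). \<Sum>j = i + 1..CARD('n) + 1. Phi U V i j *v h i j) = x \<and>
        (\<forall>i j. 1 \<le> i \<and> i < j \<and> j \<le> CARD('n) + 1 \<longrightarrow> (norm (h i j))\<^sup>2 \<le> t i j * w i j)}"
proof -
  let ?b = "unit_balance 0 (CARD('n) + 1)"
  have balance: "?b l = (if l = 0 then -1 else if l = CARD('n) + 1 then 1 else 0)" for l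
    by (simp add: unit_balance_def)
  have "closure (convex hull X_B Q) = flow_set U V ?b"
    using convex_hull_X_B_subset_flow_set[OF assms] flow_set_subset_convex_hull_X_B[OF assms]
    by (metis closed_flow_set closure_closed subset_antisym)
  moreover have "flow U V ?b w t h x z \<tau> \<longleftrightarrow>
      (\<forall>i j. i < j \<and> j \<le> CARD('n) + 1 \<longrightarrow> w i j \<ge> 0 \<and> t i j \<ge> 0) \<and>
      (\<forall>l \<in> {0..CARD('n) + 1}.
        (\<Sum>i \<in> {0..<l}. w i l) - (\<Sum>j \<in> {l + 1..CARD('n) + 1}. w l j) =
          (if l = 0 then -1 else if l = CARD('n) + 1 then 1 else 0)) \<and>
      (\<forall>l \<in> {1..CARD('n)}. z $ ix l = (\<Sum>i \<in> {0..<l}. w i l)) \<and>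
      \<tau> \<ge> (\<Sum>i = 1..CARD('n). \<Sum>j = i + 1..CARD('n) + 1. t i j) \<and>
      (\<Sum>i = 1..CARD('n). \<Sum>j = i + 1..CARD('n) + 1. Phi U V i j *v h i j) = x \<and>
      (\<forall>i j. 1 \<le> i \<and> i < j \<and> j \<le> CARD('n) + 1 \<longrightarrow> (norm (h i j))\<^sup>2 \<le> t i j * w i j)"
    for w t h x z \<tau>
  proof -
    \<comment> \<open>Passage from outflow, used in \<open>flow\<close>, to the inflow of the claim:
      both agree at nodes of \<open>[n]\<close>, where the balance is 0.\<close>
    have "(\<Sum>i \<in> {0..<l}. w i l) = (\<Sum>j \<in> {l + 1..CARD('n) + 1}. w l j)"
      if "\<forall>l \<in> {0..CARD('n) + 1}.
        (\<Sum>i \<in> {0..<l}. w i l) - (\<Sum>j \<in> {l + 1..CARD('n) + 1}. w l j) = ?b l"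
        and "l \<in> {1..CARD('n)}" for l
      using bspec[OF that(1), of l] that(2) by (simp add: unit_balance_def)
    then show ?thesis
      unfolding flow_def balance[symmetric] by (smt (verit, best))
  qed
  ultimately show ?thesis
    unfolding flow_set_def by simp
qed

end
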